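(* Let $X$ be an uncountable Polish space and call a linear order representable if it embeds into $(\mathcal{B}_1(X),<_p)$. (1) Let $\alpha<\omega_1$ and let $\{L_\beta:\beta<\alpha\}$ be linearly ordered sets each representable. Then $\prod_{\beta<\alpha}L_\beta$ ordered lexicographically is representable. (2) Suppose $L$ and every $L_p$ ($p\in L$) are representable. Then the gluing of the $L_p$'s along $L$ is representable.
   Context: An embedding of a linear order $L$ into a poset $Q$ is a map $\Phi$ with $p<q\Rightarrow\Phi(p)<\Phi(q)$. $\mathcal{B}_1(X)$: real Baire class $1$ functions on $X$ with $f<_p g$ iff $f\le g$ pointwise and $f\ne g$. The lexicographic order on $\prod_{\beta<\alpha}L_\beta$: $\bar p<\bar q$ iff $p_\delta<_{L_\delta}q_\delta$ where $\delta$ is the least index with $p_\delta\neq q_\delta$. The gluing of $(L_p)_{p\in L}$ along $L$ is the set $\{(p,q):p\in L,q\in L_p\}$ ordered by $(p,q)<(p',q')$ iff $p<_L p'$, or $p=p'$ and $q<_{L_p}q'$. *)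

theory Defs
  imports "HOL-Analysis.Analysis"
begin

text \<open>
  Linear orders and posets are reflexive relations \<open>r\<close> (as in \<^const>\<open>linear_order_on\<close>), with
  carrier \<^term>\<open>Field r\<close>; this includes the empty order. The strict order is
  \<^term>\<open>r - Id\<close>.
\<close>

text \<open>The ordinal \<open>\<omega>\<^sub>1\<close>: the least cardinal, as a well-order, greater than \<open>\<aleph>\<^sub>0\<close>.\<close>

abbreviation omega1 :: "nat set rel" where
  "omega1 \<equiv> cardSuc natLeq"

definition order_embeds :: "'a rel \<Rightarrow> 'b rel \<Rightarrow> bool" where
  \<comment> \<open>Unlike \<^const>\<open>embed\<close>, the image need not be an initial segment.\<close>
  "order_embeds r s \<longleftrightarrow>
     (\<exists>\<Phi>. \<Phi> ` Field r \<subseteq> Field s \<and> (\<forall>p q. (p, q) \<in> r - Id \<longrightarrow> (\<Phi> p, \<Phi> q) \<in> s - Id))"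

definition baire_class1 :: "('x::topological_space \<Rightarrow> real) \<Rightarrow> bool" where
  "baire_class1 f \<longleftrightarrow>
     (\<exists>F :: nat \<Rightarrow> 'x \<Rightarrow> real. (\<forall>n. continuous_on UNIV (F n)) \<and> (\<forall>x. (\<lambda>n. F n x) \<longlonglongrightarrow> f x))"

definition baire1_order :: "('x::topological_space \<Rightarrow> real) rel" where
  "baire1_order = {(f, g). baire_class1 f \<and> baire_class1 g \<and> (\<forall>x. f x \<le> g x)}"

definition representable :: "'x::topological_space itself \<Rightarrow> 'a rel \<Rightarrow> bool" where
  "representable X r \<longleftrightarrow> Linear_order r \<and> order_embeds r (baire1_order :: ('x \<Rightarrow> real) rel)"

text \<open>
  The product \<open>\<Prod>\<^sub>\<beta>\<^sub><\<^sub>\<alpha> L\<^sub>\<beta>\<close>, where the ordinal \<open>\<alpha>\<close> is a well-order whose field plays the role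
  of \<open>{\<beta>. \<beta> < \<alpha>}\<close>. Elements are extensional functions, so that equality of functions
  is equality of sequences.
\<close>

definition lex_product :: "'i rel \<Rightarrow> ('i \<Rightarrow> 'a rel) \<Rightarrow> ('i \<Rightarrow> 'a) rel" where
  "lex_product \<alpha> L =
     {(p, q). p \<in> (\<Pi>\<^sub>E \<beta>\<in>Field \<alpha>. Field (L \<beta>)) \<and> q \<in> (\<Pi>\<^sub>E \<beta>\<in>Field \<alpha>. Field (L \<beta>)) \<and>
        (p = q \<or>
         (\<exists>\<delta>\<in>Field \<alpha>. p \<delta> \<noteq> q \<delta> \<and> (\<forall>\<gamma>\<in>Field \<alpha>. p \<gamma> \<noteq> q \<gamma> \<longrightarrow> (\<delta>, \<gamma>) \<in> \<alpha>) \<and>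
            (p \<delta>, q \<delta>) \<in> L \<delta> - Id))}"

definition gluing :: "'p rel \<Rightarrow> ('p \<Rightarrow> 'q rel) \<Rightarrow> ('p \<times> 'q) rel" where
  "gluing L M =
     {((p, q), (p', q')). p \<in> Field L \<and> q \<in> Field (M p) \<and> p' \<in> Field L \<and> q' \<in> Field (M p') \<and>
        ((p, p') \<in> L - Id \<or> (p = p' \<and> (q, q') \<in> M p))}"

lemma Field_baire1_order: "Field baire1_order = {f. baire_class1 f}"
  by (auto simp: Field_def baire1_order_def)

lemma strict_baire1_order:
  "(f, g) \<in> baire1_order - Id \<longleftrightarrow> baire_class1 f \<and> baire_class1 g \<and> f \<le> g \<and> f \<noteq> g"
  by (auto simp: baire1_order_def le_fun_def)

lemma Field_lex_product: "Field (lex_product \<alpha> L) = (\<Pi>\<^sub>E \<beta>\<in>Field \<alpha>. Field (L \<beta>))"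
proof
  show "Field (lex_product \<alpha> L) \<subseteq> (\<Pi>\<^sub>E \<beta>\<in>Field \<alpha>. Field (L \<beta>))"
    unfolding Field_def[of "lex_product \<alpha> L"] by (auto simp only: lex_product_def)
  have "(p, p) \<in> lex_product \<alpha> L" if "p \<in> (\<Pi>\<^sub>E \<beta>\<in>Field \<alpha>. Field (L \<beta>))" for p
    using that by (simp add: lex_product_def)
  then show "(\<Pi>\<^sub>E \<beta>\<in>Field \<alpha>. Field (L \<beta>)) \<subseteq> Field (lex_product \<alpha> L)"
    by (auto intro: FieldI1)
qed

lemma Field_gluing:
  assumes "\<And>p. p \<in> Field L \<Longrightarrow> Linear_order (M p)"
  shows "Field (gluing L M) = (SIGMA p:Field L. Field (M p))"
proof
  show "Field (gluing L M) \<subseteq> (SIGMA p:Field L. Field (M p))"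
    unfolding Field_def[of "gluing L M"] by (auto simp only: gluing_def)
  have "((p, q), (p, q)) \<in> gluing L M" if "p \<in> Field L" "q \<in> Field (M p)" for p q
    using assms[OF that(1)] that by (auto simp: gluing_def order_on_defs refl_on_def)
  then show "(SIGMA p:Field L. Field (M p)) \<subseteq> Field (gluing L M)"
    by (auto intro: FieldI1)
qed

end

theory Submission
  imports Defs
begin

text \<open>
  Let \<open>W\<close> be the set of two-colourings of \<open>[0, 1)\<close> that are constant to the right of every point,
  ordered by the colour at the first point of disagreement. A linear order is representable on an
  uncountable Polish space iff it embeds into \<open>W\<close>, and \<open>W\<close> absorbs countable lexicographic products
  and gluings: colourings are concatenated along disjoint intervals \<open>[a, a + w)\<close> of \<open>[0, 1)\<close>.

  From \<open>W\<close> to Baire class 1: in a copy of the Cantor set of 0-1 sequences indexed by the rationals,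
  the sequences that first leave \<open>s\<close> downwards form an F-sigma set with F-sigma complement, and this
  set grows strictly with \<open>s\<close>.

  From Baire class 1 to \<open>W\<close>: for rationals \<open>p < q\<close> let \<open>A = {f \<ge> q}\<close> and \<open>B = {f \<le> p}\<close>, and start with
  the whole space and take alternately the closure of the trace of \<open>A\<close> and of \<open>B\<close>, intersecting at limits.
  By Baire's theorem this transfinite sequence of closed sets decreases to the empty set. A strictly
  antitone real function of closed sets turns them into break points of a colouring. If \<open>f\<close> grows
  then \<open>A\<close> grows and \<open>B\<close> shrinks, so at the first change the colouring moves up in \<open>W\<close>.
\<close>

section \<open>Right locally constant colourings\<close>

text \<open>Only the values on \<open>[0, 1)\<close> matter; the values elsewhere are junk.\<close>

definition right_locally_constant :: "(real \<Rightarrow> bool) \<Rightarrow> bool" where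
  "right_locally_constant s \<longleftrightarrow> (\<forall>x\<in>{0..<1}. \<exists>e>0. \<forall>y\<in>{x..<x+e}. s y = s x)"

text \<open>Right locally constant colourings that differ on [0, 1) have a first point of
  disagreement: both are constant just after the infimum, so they already differ at it.\<close>

definition lexless :: "(real \<Rightarrow> bool) \<Rightarrow> (real \<Rightarrow> bool) \<Rightarrow> bool" where
  "lexless s s' \<longleftrightarrow> (\<exists>b\<in>{0..<1}. (\<forall>x\<in>{0..<b}. s x = s' x) \<and> \<not> s b \<and> s' b)"

definition colourable :: "'a rel \<Rightarrow> bool" where
  "colourable r \<longleftrightarrow>
     (\<exists>\<Phi>. (\<forall>p\<in>Field r. right_locally_constant (\<Phi> p)) \<and>
          (\<forall>p q. (p, q) \<in> r - Id \<longrightarrow> lexless (\<Phi> p) (\<Phi> q)))"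

lemma right_locally_constantD:
  assumes "right_locally_constant s" "0 \<le> x" "x < 1"
  obtains e where "0 < e" "\<And>y. x \<le> y \<Longrightarrow> y < x + e \<Longrightarrow> s y = s x"
  using assms unfolding right_locally_constant_def by force

lemma right_locally_constant_const: "right_locally_constant (\<lambda>x. c)"
  unfolding right_locally_constant_def by (auto intro: exI[of _ 1])

section \<open>Concatenating colourings along a well-ordered family of disjoint intervals\<close>

locale slots =
  fixes \<alpha> :: "'i rel" and a w :: "'i \<Rightarrow> real"
  assumes well_order: "Well_order \<alpha>"
    and width_pos: "\<beta> \<in> Field \<alpha> \<Longrightarrow> 0 < w \<beta>"
    and left_nonneg: "\<beta> \<in> Field \<alpha> \<Longrightarrow> 0 \<le> a \<beta>"
    and right_le_1: "\<beta> \<in> Field \<alpha> \<Longrightarrow> a \<beta> + w \<beta> \<le> 1"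
    and consecutive: "(\<gamma>, \<beta>) \<in> \<alpha> - Id \<Longrightarrow> a \<gamma> + w \<gamma> \<le> a \<beta>"
begin

definition concat_slots :: "('i \<Rightarrow> real \<Rightarrow> bool) \<Rightarrow> real \<Rightarrow> bool" where
  "concat_slots s x \<longleftrightarrow>
     (\<exists>\<beta>\<in>Field \<alpha>. a \<beta> \<le> x \<and> x < a \<beta> + w \<beta> \<and> s \<beta> ((x - a \<beta>) / w \<beta>))"

lemma trichotomy:
  assumes "\<gamma> \<in> Field \<alpha>" "\<beta> \<in> Field \<alpha>"
  obtains "\<gamma> = \<beta>" | "(\<gamma>, \<beta>) \<in> \<alpha> - Id" | "(\<beta>, \<gamma>) \<in> \<alpha> - Id"
  using well_order assms by (auto simp: order_on_defs total_on_def)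

lemma slot_unique:
  assumes "\<gamma> \<in> Field \<alpha>" "\<beta> \<in> Field \<alpha>" "a \<beta> \<le> x" "x < a \<beta> + w \<beta>" "a \<gamma> \<le> x" "x < a \<gamma> + w \<gamma>"
  shows "\<gamma> = \<beta>"
  using trichotomy[OF assms(1,2)]
  by cases (use consecutive assms in force)+

lemma concat_slots_in:
  assumes "\<beta> \<in> Field \<alpha>" "a \<beta> \<le> x" "x < a \<beta> + w \<beta>"
  shows "concat_slots s x = s \<beta> ((x - a \<beta>) / w \<beta>)"
  using slot_unique assms unfolding concat_slots_def by blast

lemma least_slot:
  assumes "P \<beta>" "\<beta> \<in> Field \<alpha>"
  obtains \<mu> where "\<mu> \<in> Field \<alpha>" "P \<mu>" "\<And>\<gamma>. (\<gamma>, \<mu>) \<in> \<alpha> - Id \<Longrightarrow> \<not> P \<gamma>"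
proof -
  have "wf (\<alpha> - Id)"
    using well_order by (simp add: well_order_on_def)
  then obtain \<mu> where "\<mu> \<in> {\<beta>\<in>Field \<alpha>. P \<beta>}" "\<And>\<gamma>. (\<gamma>, \<mu>) \<in> \<alpha> - Id \<Longrightarrow> \<gamma> \<notin> {\<beta>\<in>Field \<alpha>. P \<beta>}"
    using assms by (elim wfE_min[where Q = "{\<beta>\<in>Field \<alpha>. P \<beta>}"]) auto
  then show thesis
    using that by (auto intro: FieldI1)
qed

text \<open>Well-ordering prevents slots from accumulating at \<open>x\<close> from the right:
  outside the slots, colour \<open>False\<close> persists up to the left end of the least slot that
  starts after \<open>x\<close>, or forever if there is none. Inside a slot the colouring is only
  rescaled.\<close>

lemma right_locally_constant_concat_slots:
  assumes "\<And>\<beta>. \<beta> \<in> Field \<alpha> \<Longrightarrow> right_locally_constant (s \<beta>)"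
  shows "right_locally_constant (concat_slots s)"
  unfolding right_locally_constant_def
proof
  fix x :: real
  assume x: "x \<in> {0..<1}"
  consider \<beta> where "\<beta> \<in> Field \<alpha>" "a \<beta> \<le> x" "x < a \<beta> + w \<beta>"
    | \<beta> where "\<And>\<beta>. \<beta> \<in> Field \<alpha> \<Longrightarrow> a \<beta> \<le> x \<Longrightarrow> a \<beta> + w \<beta> \<le> x" "\<beta> \<in> Field \<alpha>" "x < a \<beta>"
    | "\<And>\<beta>. \<beta> \<in> Field \<alpha> \<Longrightarrow> a \<beta> \<le> x" "\<And>\<beta>. \<beta> \<in> Field \<alpha> \<Longrightarrow> a \<beta> + w \<beta> \<le> x"
    by (metis linorder_not_less)
  then show "\<exists>e>0. \<forall>y\<in>{x..<x + e}. concat_slots s y = concat_slots s x"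
  proof cases
    case (1 \<beta>)
    have w: "0 < w \<beta>"
      using width_pos 1 by blast
    obtain e where e: "0 < e"
      "\<And>y. (x - a \<beta>) / w \<beta> \<le> y \<Longrightarrow> y < (x - a \<beta>) / w \<beta> + e \<Longrightarrow> s \<beta> y = s \<beta> ((x - a \<beta>) / w \<beta>)"
      using right_locally_constantD[OF assms[OF 1(1)], of "(x - a \<beta>) / w \<beta>"] 1 w by (auto simp: field_simps)
    show ?thesis
    proof (intro exI conjI ballI)
      show "0 < min (e * w \<beta>) (a \<beta> + w \<beta> - x)"
        using e w 1 by simp
      fix y assume y: "y \<in> {x..<x + min (e * w \<beta>) (a \<beta> + w \<beta> - x)}"
      have "concat_slots s y = s \<beta> ((y - a \<beta>) / w \<beta>)"
        by (rule concat_slots_in) (use y 1 in auto)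
      also have "\<dots> = s \<beta> ((x - a \<beta>) / w \<beta>)"
        by (rule e(2)) (use y w in \<open>auto simp: field_simps\<close>)
      also have "\<dots> = concat_slots s x"
        using 1 by (simp add: concat_slots_in)
      finally show "concat_slots s y = concat_slots s x" .
    qed
  next
    case (2 \<beta>)
    obtain \<mu> where \<mu>: "\<mu> \<in> Field \<alpha>" "x < a \<mu>" "\<And>\<gamma>. (\<gamma>, \<mu>) \<in> \<alpha> - Id \<Longrightarrow> \<not> x < a \<gamma>"
      using least_slot[of "\<lambda>\<beta>. x < a \<beta>"] 2 by metis
    have "\<not> concat_slots s y" if y: "x \<le> y" "y < a \<mu>" for y
    proof
      assume "concat_slots s y"
      then obtain \<gamma> where \<gamma>: "\<gamma> \<in> Field \<alpha>" "a \<gamma> \<le> y" "y < a \<gamma> + w \<gamma>"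
        unfolding concat_slots_def by blast
      from \<gamma>(1) \<mu>(1) show False
      proof (cases rule: trichotomy)
        case 1
        then show False using \<gamma> y by simp
      next
        case 2
        then show False using \<mu>(3) \<gamma> y \<open>\<And>\<beta>. \<beta> \<in> Field \<alpha> \<Longrightarrow> a \<beta> \<le> x \<Longrightarrow> a \<beta> + w \<beta> \<le> x\<close> by force
      next
        case 3
        then show False using consecutive[OF 3] width_pos[OF \<mu>(1)] \<gamma> y by simp
      qed
    qed
    then show ?thesis
      using \<mu>(2) by (intro exI[of _ "a \<mu> - x"]) auto
  next
    case 3
    then have "\<not> concat_slots s y" if "x \<le> y" for y
      using that by (force simp: concat_slots_def)
    then show ?thesis
      by (intro exI[of _ 1]) auto
  qed
qed

text \<open>Earlier slots contribute equal colours and later ones start beyond the slot of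
  \<open>\<delta>\<close>, so the first disagreement there is merely rescaled.\<close>

lemma lexless_concat_slots:
  assumes \<delta>: "\<delta> \<in> Field \<alpha>" and less: "lexless (s \<delta>) (s' \<delta>)"
    and before: "\<And>\<gamma> x. (\<gamma>, \<delta>) \<in> \<alpha> - Id \<Longrightarrow> x \<in> {0..<1} \<Longrightarrow> s \<gamma> x = s' \<gamma> x"
  shows "lexless (concat_slots s) (concat_slots s')"
proof -
  obtain b where b: "b \<in> {0..<1}" "\<And>x. x \<in> {0..<b} \<Longrightarrow> s \<delta> x = s' \<delta> x" "\<not> s \<delta> b" "s' \<delta> b"
    using less unfolding lexless_def by blast
  have w: "0 < w \<delta>"
    using width_pos \<delta> by blast
  let ?b = "a \<delta> + w \<delta> * b"
  have lt: "?b < a \<delta> + w \<delta>"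
    using b w by simp
  have "s \<gamma> ((x - a \<gamma>) / w \<gamma>) = s' \<gamma> ((x - a \<gamma>) / w \<gamma>)"
    if \<gamma>: "\<gamma> \<in> Field \<alpha>" "a \<gamma> \<le> x" "x < a \<gamma> + w \<gamma>" and x: "x < ?b" for \<gamma> x
    using \<gamma>(1) \<delta>
  proof (cases rule: trichotomy)
    case 1
    have "x - a \<delta> < b * w \<delta>"
      using x by (simp add: algebra_simps)
    then show ?thesis
      using 1 \<gamma> x w by (auto simp: b(2) divide_less_eq)
  next
    case 2
    then show ?thesis
      using before \<gamma> width_pos[OF \<gamma>(1)] by (simp add: divide_less_eq)
  next
    case 3
    then have False
      using consecutive[OF 3] \<gamma> x lt by simp
    then show ?thesis ..
  qed
  then have "concat_slots s x = concat_slots s' x" if "x \<in> {0..<?b}" for x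
    using that unfolding concat_slots_def by auto
  moreover have "?b \<in> {0..<1}"
    using lt b(1) w left_nonneg[OF \<delta>] right_le_1[OF \<delta>] less_le_trans[OF lt] by auto
  moreover have "concat_slots t ?b = t \<delta> b" for t
    using concat_slots_in[OF \<delta>, of ?b t] w b lt by simp
  ultimately show ?thesis
    using b unfolding lexless_def by metis
qed

end

lemma slots_exist:
  assumes wo: "Well_order \<alpha>" and "countable (Field \<alpha>)"
  obtains a w where "slots \<alpha> a w"
proof -
  \<comment> \<open>Widths 2^-(n+1) along an enumeration of the field have total at most 1. Taking
    as left end the sum of the widths of all strict predecessors makes the slots consecutive, also
    at limit elements of \<open>\<alpha>\<close>.\<close>
  define w :: "'a \<Rightarrow> real" where "w \<beta> = (1/2) ^ Suc (to_nat_on (Field \<alpha>) \<beta>)" for \<beta>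
  have inj: "inj_on (to_nat_on (Field \<alpha>)) (Field \<alpha>)"
    using assms(2) by (rule inj_on_to_nat_on)
  have geo: "(\<lambda>n. (1/2::real) ^ Suc n) summable_on UNIV" "infsum (\<lambda>n. (1/2::real) ^ Suc n) UNIV = 1"
  proof -
    have "((\<lambda>n. (1/2::real) ^ Suc n) has_sum 1) UNIV"
      using power_half_series by (intro norm_summable_imp_has_sum) (auto simp: sums_iff)
    then show "(\<lambda>n. (1/2::real) ^ Suc n) summable_on UNIV" "infsum (\<lambda>n. (1/2::real) ^ Suc n) UNIV = 1"
      by (auto simp: summable_on_def infsumI)
  qed
  have w_comp: "w = (\<lambda>n. (1/2) ^ Suc n) \<circ> to_nat_on (Field \<alpha>)"
    by (auto simp: w_def)
  have sub: "(\<lambda>n. (1/2::real) ^ Suc n) summable_on S" for S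
    using geo(1) summable_on_subset_banach by blast
  have w_sum: "w summable_on A" if "A \<subseteq> Field \<alpha>" for A
    unfolding w_comp using sub inj_on_subset[OF inj that] by (subst summable_on_reindex[symmetric]) auto
  have w_le: "infsum w A \<le> 1" if "A \<subseteq> Field \<alpha>" for A
  proof -
    have "infsum w A = infsum (\<lambda>n. (1/2) ^ Suc n) (to_nat_on (Field \<alpha>) ` A)"
      unfolding w_comp using inj_on_subset[OF inj that] by (subst infsum_reindex) auto
    also have "\<dots> \<le> infsum (\<lambda>n. (1/2::real) ^ Suc n) UNIV"
      using sub by (intro infsum_mono_neutral) auto
    finally show ?thesis using geo by simp
  qed
  define below where "below \<beta> = {\<gamma>. (\<gamma>, \<beta>) \<in> \<alpha> - Id}" for \<beta>
  define a where "a \<beta> = infsum w (below \<beta>)" for \<beta>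
  have below: "below \<beta> \<subseteq> Field \<alpha>" "\<beta> \<notin> below \<beta>" for \<beta>
    by (auto simp: below_def Field_def)
  have pos: "0 < w \<beta>" for \<beta>
    by (simp add: w_def)
  have ins: "a \<beta> + w \<beta> = infsum w (insert \<beta> (below \<beta>))" if "\<beta> \<in> Field \<alpha>" for \<beta>
    using below w_sum by (subst infsum_insert) (auto simp: a_def)
  have "slots \<alpha> a w"
  proof
    show "0 \<le> a \<beta>" for \<beta>
      unfolding a_def using pos by (intro infsum_nonneg) (auto intro: less_imp_le)
    show "a \<beta> + w \<beta> \<le> 1" if "\<beta> \<in> Field \<alpha>" for \<beta>
      using ins that w_le below by (metis insert_subset)
    show "a \<gamma> + w \<gamma> \<le> a \<beta>" if "(\<gamma>, \<beta>) \<in> \<alpha> - Id" for \<gamma> \<beta>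
    proof -
      have \<gamma>: "\<gamma> \<in> Field \<alpha>"
        using that by (auto simp: Field_def)
      have "trans (\<alpha> - Id)" "antisym \<alpha>"
        using wo by (auto simp: order_on_defs intro: trans_diff_Id)
      then have "insert \<gamma> (below \<gamma>) \<subseteq> below \<beta>"
        using that unfolding below_def by (blast dest: transD)
      then show ?thesis
        unfolding ins[OF \<gamma>] a_def[of \<beta>] using below w_sum pos \<gamma>
        by (intro infsum_mono_neutral w_sum) (auto intro: less_imp_le)
    qed
  qed (use wo pos in auto)
  then show thesis ..
qed

section \<open>Closure of colourable orders under lexicographic products and gluings\<close>

lemma colourable_lex_product:
  assumes wo: "Well_order \<alpha>" and "countable (Field \<alpha>)"
    and col: "\<And>\<beta>. \<beta> \<in> Field \<alpha> \<Longrightarrow> colourable (L \<beta>)"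
  shows "colourable (lex_product \<alpha> L)"
proof -
  obtain a w where "slots \<alpha> a w"
    using slots_exist assms by blast
  then interpret slots \<alpha> a w .
  obtain \<Phi> where \<Phi>: "\<And>\<beta> p. \<beta> \<in> Field \<alpha> \<Longrightarrow> p \<in> Field (L \<beta>) \<Longrightarrow> right_locally_constant (\<Phi> \<beta> p)"
    "\<And>\<beta> p q. \<beta> \<in> Field \<alpha> \<Longrightarrow> (p, q) \<in> L \<beta> - Id \<Longrightarrow> lexless (\<Phi> \<beta> p) (\<Phi> \<beta> q)"
    using col unfolding colourable_def by metis
  define \<Psi> where "\<Psi> p = concat_slots (\<lambda>\<beta>. \<Phi> \<beta> (p \<beta>))" for p
  show ?thesis
    unfolding colourable_def
  proof (intro exI[of _ \<Psi>] conjI ballI allI impI)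
    fix p assume "p \<in> Field (lex_product \<alpha> L)"
    then show "right_locally_constant (\<Psi> p)"
      unfolding \<Psi>_def Field_lex_product
      by (intro right_locally_constant_concat_slots \<Phi>) auto
  next
    fix p q assume "(p, q) \<in> lex_product \<alpha> L - Id"
    then obtain \<delta> where \<delta>: "\<delta> \<in> Field \<alpha>" "\<forall>\<gamma>\<in>Field \<alpha>. p \<gamma> \<noteq> q \<gamma> \<longrightarrow> (\<delta>, \<gamma>) \<in> \<alpha>"
      "(p \<delta>, q \<delta>) \<in> L \<delta> - Id"
      by (auto simp: lex_product_def)
    have "antisym \<alpha>"
      using wo by (simp add: order_on_defs)
    then have "p \<gamma> = q \<gamma>" if "(\<gamma>, \<delta>) \<in> \<alpha> - Id" for \<gamma>
      using \<delta>(2) that by (auto dest: antisymD intro: FieldI1)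
    then show "lexless (\<Psi> p) (\<Psi> q)"
      unfolding \<Psi>_def using \<delta> by (intro lexless_concat_slots[of \<delta>] \<Phi>) auto
  qed
qed

lemma colourable_gluing:
  assumes lin: "\<And>p. p \<in> Field L \<Longrightarrow> Linear_order (M p)"
    and L: "colourable L" and M: "\<And>p. p \<in> Field L \<Longrightarrow> colourable (M p)"
  shows "colourable (gluing L M)"
proof -
  obtain a w where "slots natLeq a w"
    using slots_exist[OF natLeq_Well_order] by auto
  then interpret slots natLeq a w .
  obtain \<Phi> where \<Phi>: "\<And>p. p \<in> Field L \<Longrightarrow> right_locally_constant (\<Phi> p)"
    "\<And>p q. (p, q) \<in> L - Id \<Longrightarrow> lexless (\<Phi> p) (\<Phi> q)"
    using L unfolding colourable_def by metis
  obtain \<Psi> where \<Psi>: "\<And>p q. p \<in> Field L \<Longrightarrow> q \<in> Field (M p) \<Longrightarrow> right_locally_constant (\<Psi> p q)"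
    "\<And>p q q'. p \<in> Field L \<Longrightarrow> (q, q') \<in> M p - Id \<Longrightarrow> lexless (\<Psi> p q) (\<Psi> p q')"
    using M unfolding colourable_def by metis
  \<comment> \<open>Slot 0 compares the first components. All later slots repeat the colouring of
    the second component, and slot 1 decides when the first components are equal.\<close>
  define \<Theta> where "\<Theta> = (\<lambda>(p, q). concat_slots (\<lambda>n::nat. if n = 0 then \<Phi> p else \<Psi> p q))"
  show ?thesis
    unfolding colourable_def
  proof (intro exI[of _ \<Theta>] conjI ballI allI impI)
    fix x assume "x \<in> Field (gluing L M)"
    then have "x \<in> (SIGMA p:Field L. Field (M p))"
      using Field_gluing[of L M] lin by simp
    then show "right_locally_constant (\<Theta> x)"
      unfolding \<Theta>_def
      by (auto intro!: right_locally_constant_concat_slots \<Phi> \<Psi>)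
  next
    fix x y assume xy: "(x, y) \<in> gluing L M - Id"
    obtain p q p' q' where pq: "x = (p, q)" "y = (p', q')"
      by (cases x, cases y)
    consider "(p, p') \<in> L - Id" | "p = p'" "(q, q') \<in> M p - Id" "p \<in> Field L"
      using xy unfolding pq gluing_def by auto
    then show "lexless (\<Theta> x) (\<Theta> y)"
    proof cases
      case 1
      then show ?thesis
        unfolding pq \<Theta>_def prod.case using \<Phi>
        by (intro lexless_concat_slots[of 0]) (auto simp: natLeq_def Field_natLeq[unfolded natLeq_def])
    next
      case 2
      then show ?thesis
        unfolding pq \<Theta>_def prod.case using \<Psi>
        by (intro lexless_concat_slots[of 1]) (auto simp: natLeq_def Field_natLeq[unfolded natLeq_def])
    qed
  qed
qed

section \<open>Linearity of gluings and lexicographic products\<close>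

lemma Linear_order_gluing:
  assumes L: "Linear_order L" and M: "\<And>p. p \<in> Field L \<Longrightarrow> Linear_order (M p)"
  shows "Linear_order (gluing L M)"
proof -
  have F: "Field (gluing L M) = (SIGMA p:Field L. Field (M p))"
    using Field_gluing[of L M] M by simp
  have tL: "trans L" "antisym L" "total_on (Field L) L"
    using L by (auto simp: order_on_defs)
  have tM: "trans (M p)" "antisym (M p)" "total_on (Field (M p)) (M p)" "refl_on (Field (M p)) (M p)"
    if "p \<in> Field L" for p
    using M[OF that] by (auto simp: order_on_defs)
  have "refl_on (Field (gluing L M)) (gluing L M)"
    using tM(4) unfolding F by (auto simp: refl_on_def gluing_def)
  moreover have "gluing L M \<subseteq> Field (gluing L M) \<times> Field (gluing L M)"
    by (auto intro: FieldI1 FieldI2)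
  moreover have "trans (gluing L M)"
  proof (rule transI)
    fix x y z assume xy: "(x, y) \<in> gluing L M" and yz: "(y, z) \<in> gluing L M"
    have L': "(p, r) \<in> L \<and> p \<noteq> r" if "(p, q) \<in> L" "p \<noteq> q" "(q, r) \<in> L" "q \<noteq> r" for p q r
      using tL that by (meson transD antisymD)
    have M': "(q, s) \<in> M p" if "(q, r) \<in> M p" "(r, s) \<in> M p" "p \<in> Field L" for p q r s
      using tM(1)[OF that(3)] that(1,2) by (rule transD)
    show "(x, z) \<in> gluing L M"
      using xy yz unfolding gluing_def
      by (cases x; cases y; cases z) (auto intro: M' dest: L')
  qed
  moreover have "antisym (gluing L M)"
  proof (rule antisymI)
    fix x y assume "(x, y) \<in> gluing L M" "(y, x) \<in> gluing L M"
    then show "x = y"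
      using tL(2) tM(2) unfolding gluing_def
      by (cases x; cases y) (auto dest: antisymD)
  qed
  moreover have "total_on (Field (gluing L M)) (gluing L M)"
    unfolding F
  proof (rule total_onI)
    fix x y assume "x \<in> (SIGMA p:Field L. Field (M p))" "y \<in> (SIGMA p:Field L. Field (M p))" "x \<noteq> y"
    then obtain p q p' q' where "x = (p, q)" "y = (p', q')" "p \<in> Field L" "p' \<in> Field L"
      "q \<in> Field (M p)" "q' \<in> Field (M p')" "p \<noteq> p' \<or> q \<noteq> q'"
      by auto
    then show "(x, y) \<in> gluing L M \<or> (y, x) \<in> gluing L M"
      using tL(3) tM(3)[of p] unfolding total_on_def gluing_def
      by (cases "p = p'") auto
  qed
  ultimately show ?thesis
    by (simp add: order_on_defs)
qed

lemma Linear_order_lex_product: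
  assumes wo: "Well_order \<alpha>" and L: "\<And>\<beta>. \<beta> \<in> Field \<alpha> \<Longrightarrow> Linear_order (L \<beta>)"
  shows "Linear_order (lex_product \<alpha> L)"
proof -
  have tL: "trans (L p)" "antisym (L p)" "total_on (Field (L p)) (L p)" if "p \<in> Field \<alpha>" for p
    using L[OF that] by (auto simp: order_on_defs)
  have t\<alpha>: "trans \<alpha>" "antisym \<alpha>" "total_on (Field \<alpha>) \<alpha>" "refl_on (Field \<alpha>) \<alpha>" "wf (\<alpha> - Id)"
    using wo by (auto simp: order_on_defs)
  have "refl_on (Field (lex_product \<alpha> L)) (lex_product \<alpha> L)"
    unfolding Field_lex_product by (auto simp: refl_on_def lex_product_def)
  moreover have "lex_product \<alpha> L \<subseteq> Field (lex_product \<alpha> L) \<times> Field (lex_product \<alpha> L)"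
    by (auto intro: FieldI1 FieldI2)
  moreover have "trans (lex_product \<alpha> L)"
  proof (rule transI)
    fix p q r assume pq: "(p, q) \<in> lex_product \<alpha> L" and qr: "(q, r) \<in> lex_product \<alpha> L"
    show "(p, r) \<in> lex_product \<alpha> L"
    proof (cases "p = q \<or> q = r")
      case False
      obtain d where d: "d \<in> Field \<alpha>" "\<And>c. c \<in> Field \<alpha> \<Longrightarrow> p c \<noteq> q c \<Longrightarrow> (d, c) \<in> \<alpha>" "(p d, q d) \<in> L d - Id"
        using pq False by (auto simp: lex_product_def)
      obtain e where e: "e \<in> Field \<alpha>" "\<And>c. c \<in> Field \<alpha> \<Longrightarrow> q c \<noteq> r c \<Longrightarrow> (e, c) \<in> \<alpha>" "(q e, r e) \<in> L e - Id"
        using qr False by (auto simp: lex_product_def)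
      have PE: "p \<in> (\<Pi>\<^sub>E \<beta>\<in>Field \<alpha>. Field (L \<beta>))" "r \<in> (\<Pi>\<^sub>E \<beta>\<in>Field \<alpha>. Field (L \<beta>))"
        using pq qr by (auto simp: lex_product_def)
      \<comment> \<open>The first difference of \<open>p\<close> and \<open>r\<close> is the earlier
        of \<open>d\<close> and \<open>e\<close>.\<close>
      consider "d = e" | "(d, e) \<in> \<alpha>" "d \<noteq> e" | "(e, d) \<in> \<alpha>" "d \<noteq> e"
        using t\<alpha>(3) d(1) e(1) by (auto simp: total_on_def)
      then have "\<exists>m\<in>Field \<alpha>. (\<forall>c\<in>Field \<alpha>. p c \<noteq> r c \<longrightarrow> (m, c) \<in> \<alpha>) \<and> (p m, r m) \<in> L m - Id"
      proof cases
        case 1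
        have "(p d, r d) \<in> L d - Id"
          using d e 1 tL(1,2)[OF d(1)] by (auto dest: transD antisymD)
        then show ?thesis
          using d e 1 by (intro bexI[of _ d]) metis+
      next
        case 2
        then have "q d = r d"
          using e(2)[OF d(1)] t\<alpha>(2) by (auto dest: antisymD)
        moreover have "(d, c) \<in> \<alpha>" if "c \<in> Field \<alpha>" "p c \<noteq> r c" for c
          using d(2) e(2) that 2(1) t\<alpha>(1) by (metis transD)
        ultimately show ?thesis
          using d by (intro bexI[of _ d]) auto
      next
        case 3
        then have "p e = q e"
          using d(2)[OF e(1)] t\<alpha>(2) by (auto dest: antisymD)
        moreover have "(e, c) \<in> \<alpha>" if "c \<in> Field \<alpha>" "p c \<noteq> r c" for c
          using d(2) e(2) that 3(1) t\<alpha>(1) by (metis transD)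
        ultimately show ?thesis
          using e by (intro bexI[of _ e]) auto
      qed
      then show ?thesis
        using PE by (auto simp: lex_product_def)
    qed (use pq qr in auto)
  qed
  moreover have "antisym (lex_product \<alpha> L)"
  proof (rule antisymI, rule ccontr)
    fix p q assume pq: "(p, q) \<in> lex_product \<alpha> L" and qp: "(q, p) \<in> lex_product \<alpha> L" and "p \<noteq> q"
    obtain d where d: "d \<in> Field \<alpha>" "\<And>c. c \<in> Field \<alpha> \<Longrightarrow> p c \<noteq> q c \<Longrightarrow> (d, c) \<in> \<alpha>" "(p d, q d) \<in> L d - Id"
      using pq \<open>p \<noteq> q\<close> by (auto simp: lex_product_def)
    obtain e where e: "e \<in> Field \<alpha>" "\<And>c. c \<in> Field \<alpha> \<Longrightarrow> q c \<noteq> p c \<Longrightarrow> (e, c) \<in> \<alpha>" "(q e, p e) \<in> L e - Id"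
      using qp \<open>p \<noteq> q\<close> by (auto simp: lex_product_def)
    have "d = e"
      using d(2)[OF e(1)] e(2)[OF d(1)] d(3) e(3) t\<alpha>(2) by (auto dest: antisymD)
    then show False
      using d(3) e(3) tL(2)[OF d(1)] by (auto dest: antisymD)
  qed
  moreover have "total_on (Field (lex_product \<alpha> L)) (lex_product \<alpha> L)"
    unfolding Field_lex_product
  proof (rule total_onI)
    fix p q assume p: "p \<in> (\<Pi>\<^sub>E \<beta>\<in>Field \<alpha>. Field (L \<beta>))" and q: "q \<in> (\<Pi>\<^sub>E \<beta>\<in>Field \<alpha>. Field (L \<beta>))"
      and "p \<noteq> q"
    then obtain c where "c \<in> Field \<alpha>" "p c \<noteq> q c"
      by (meson PiE_ext)
    then obtain d where d: "d \<in> Field \<alpha>" "p d \<noteq> q d"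
      "\<And>c. (c, d) \<in> \<alpha> - Id \<Longrightarrow> c \<notin> {c\<in>Field \<alpha>. p c \<noteq> q c}"
      using wfE_min[OF t\<alpha>(5), of c "{c\<in>Field \<alpha>. p c \<noteq> q c}"] by blast
    have "(d, c) \<in> \<alpha>" if "c \<in> Field \<alpha>" "p c \<noteq> q c" for c
      using d that t\<alpha>(3,4) unfolding total_on_def refl_on_def by (cases "c = d") auto
    moreover have "(p d, q d) \<in> L d - Id \<or> (q d, p d) \<in> L d - Id"
      using tL(3)[OF d(1)] p q d(1,2) by (auto simp: total_on_def)
    ultimately show "(p, q) \<in> lex_product \<alpha> L \<or> (q, p) \<in> lex_product \<alpha> L"
      using p q d(1,2) unfolding lex_product_def by fastforce
  qed
  ultimately show ?thesis
    by (simp add: order_on_defs)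
qed

section \<open>From colourings to Baire class 1 functions\<close>

abbreviation unit_rats :: "real set" where
  "unit_rats \<equiv> \<rat> \<inter> {0..<1}"

text \<open>\<open>deviates True z s\<close> expresses that \<open>z\<close> first leaves
  \<open>s\<close> downwards. The disagreements need not have a first element, so \<open>q\<close>
  may be any disagreement in the first run: a rational \<open>r < q\<close> may disagree too if
  \<open>s\<close> has colour \<open>c\<close> throughout [r, q], and it then disagrees in the same
  direction. For fixed \<open>q\<close> this only prescribes values of \<open>z\<close> at
  rationals, which will be closed conditions.\<close>

definition deviates :: "bool \<Rightarrow> (real \<Rightarrow> bool) \<Rightarrow> (real \<Rightarrow> bool) \<Rightarrow> bool" where
  "deviates c z s \<longleftrightarrow>
     (\<exists>q\<in>unit_rats. s q = c \<and> z q \<noteq> c \<and>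
        (\<forall>r\<in>unit_rats. r < q \<longrightarrow> (\<exists>y\<in>{r..q}. s y \<noteq> c) \<longrightarrow> z r = s r))"

lemma unit_rats_between:
  assumes "0 \<le> b" "b < 1" "0 < e"
  obtains q where "q \<in> unit_rats" "b \<le> q" "q < b + e"
proof -
  obtain q where "q \<in> \<rat>" "b < q" "q < min 1 (b + e)"
    using Rats_dense_in_real[of b "min 1 (b + e)"] assms by auto
  then show thesis
    using assms by (intro that[of q]) auto
qed

lemma not_deviates_if_agree: "\<forall>q\<in>unit_rats. z q = s q \<Longrightarrow> \<not> deviates c z s"
  unfolding deviates_def by blast

text \<open>Of two witnesses of opposite colours, the later one sees a colour change at the earlier
  one and so forces agreement there.\<close>

lemma deviates_exclusive: "deviates True z s \<Longrightarrow> \<not> deviates False z s"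
proof
  assume "deviates True z s" "deviates False z s"
  then obtain q r where q: "q \<in> unit_rats" "s q" "\<not> z q"
    "\<And>p. p \<in> unit_rats \<Longrightarrow> p < q \<Longrightarrow> \<exists>y\<in>{p..q}. \<not> s y \<Longrightarrow> z p = s p"
    and r: "r \<in> unit_rats" "\<not> s r" "z r"
    "\<And>p. p \<in> unit_rats \<Longrightarrow> p < r \<Longrightarrow> \<exists>y\<in>{p..r}. s y \<Longrightarrow> z p = s p"
    unfolding deviates_def by auto
  consider "q < r" | "r < q"
    using q r by force
  then show False
    using q(1-3) r(1-3) q(4)[of r] r(4)[of q] by cases force+
qed

text \<open>Let \<open>t\<close> be the infimum of the disagreements. As \<open>s\<close> is
  constant just after \<open>t\<close>, any disagreement close to \<open>t\<close> is a witness of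
  colour \<open>s t\<close>: a rational separated from it by another colour lies before
  \<open>t\<close>.\<close>

lemma deviates_total:
  assumes s: "right_locally_constant s" and q: "q \<in> unit_rats" "z q \<noteq> s q"
  shows "deviates True z s \<or> deviates False z s"
proof -
  define Q where "Q = {q \<in> unit_rats. z q \<noteq> s q}"
  define t where "t = Inf Q"
  have bdd: "bdd_below Q"
    by (rule bdd_belowI[of _ 0]) (auto simp: Q_def)
  have "q \<in> Q"
    using q by (simp add: Q_def)
  have t: "0 \<le> t" "t < 1"
  proof -
    show "0 \<le> t"
      unfolding t_def using \<open>q \<in> Q\<close> by (intro cInf_greatest) (auto simp: Q_def)
    have "t \<le> q"
      unfolding t_def using \<open>q \<in> Q\<close> bdd by (rule cInf_lower)
    then show "t < 1"
      using q by simp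
  qed
  obtain e where e: "0 < e" "\<And>y. t \<le> y \<Longrightarrow> y < t + e \<Longrightarrow> s y = s t"
    using right_locally_constantD[OF s t] by metis
  obtain p where p: "p \<in> Q" "p < t + e"
    using cInf_lessD[of Q "t + e"] \<open>q \<in> Q\<close> e(1) by (auto simp: t_def)
  have "t \<le> p"
    unfolding t_def using p(1) bdd by (rule cInf_lower)
  have "deviates (s t) z s"
    unfolding deviates_def
  proof (intro bexI[of _ p] conjI ballI impI)
    fix r assume r: "r \<in> unit_rats" "\<exists>y\<in>{r..p}. s y \<noteq> s t"
    then obtain y where "r \<le> y" "y \<le> p" "s y \<noteq> s t"
      by auto
    then have "r < t"
      using e(2)[of y] p(2) by (cases "t \<le> y") auto
    then have "r \<notin> Q"
      using cInf_lower[OF _ bdd, of r] unfolding t_def by auto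
    then show "z r = s r"
      using r(1) by (simp add: Q_def)
  qed (use p \<open>t \<le> p\<close> e(2)[of p] in \<open>auto simp: Q_def\<close>)
  then show ?thesis
    by (cases "s t") auto
qed

text \<open>A witness before the first difference \<open>b\<close> of \<open>s\<close> and
  \<open>s'\<close> still works. Any other witness forces \<open>z\<close> to agree with
  \<open>s\<close> below \<open>b + e\<close>, hence to be \<open>False\<close> just after
  \<open>b\<close>, where \<open>s'\<close> is \<open>True\<close>; a rational there is a new
  witness.\<close>

lemma deviates_mono:
  assumes s: "right_locally_constant s" and s': "right_locally_constant s'"
    and less: "lexless s s'" and z: "deviates True z s"
  shows "deviates True z s'"
proof -
  obtain b where b: "b \<in> {0..<1}" "\<And>x. x \<in> {0..<b} \<Longrightarrow> s x = s' x" "\<not> s b" "s' b"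
    using less unfolding lexless_def by blast
  obtain q where q: "q \<in> unit_rats" "s q" "\<not> z q"
    "\<And>r. r \<in> unit_rats \<Longrightarrow> r < q \<Longrightarrow> \<exists>y\<in>{r..q}. \<not> s y \<Longrightarrow> z r = s r"
    using z unfolding deviates_def by auto
  show ?thesis
  proof (cases "q < b")
    case True
    then show ?thesis
      unfolding deviates_def using q b(2) by (intro bexI[of _ q]) auto
  next
    case False
    obtain e where e: "0 < e" "\<And>y. b \<le> y \<Longrightarrow> y < b + e \<Longrightarrow> \<not> s y"
      using right_locally_constantD[OF s, of b] b by auto
    obtain e' where e': "0 < e'" "\<And>y. b \<le> y \<Longrightarrow> y < b + e' \<Longrightarrow> s' y"
      using right_locally_constantD[OF s', of b] b by auto
    have agree: "z r = s r" if r: "r \<in> unit_rats" "r < b + e" for r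
    proof -
      have "b + e \<le> q"
        using e(2)[of q] q False by force
      moreover have "\<not> s (max r b)"
        using e r by (cases "r \<le> b") auto
      ultimately show ?thesis
        using r q(4)[of r] e(1) by force
    qed
    obtain p where p: "p \<in> unit_rats" "b \<le> p" "p < b + min e e'"
      using unit_rats_between[of b "min e e'"] b(1) e e' by auto
    show ?thesis
      unfolding deviates_def
    proof (intro bexI[of _ p] conjI ballI impI)
      show "s' p = True" "z p \<noteq> True"
        using p e e' agree[of p] by auto
      fix r assume r: "r \<in> unit_rats" "\<exists>y\<in>{r..p}. s' y \<noteq> True"
      then obtain y where "r \<le> y" "y \<le> p" "\<not> s' y"
        by auto
      then have "r < b"
        using e'(2)[of y] p(3) by (cases "b \<le> y") auto
      then show "z r = s' r"
        using agree[of r] e(1) b(2)[of r] r(1) by auto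
    qed fact
  qed
qed

text \<open>This gives strictness: a point with code \<open>s\<close> will lie in the set attached
  to \<open>s'\<close> but not in the one attached to \<open>s\<close>.\<close>

lemma deviates_lexless:
  assumes s: "right_locally_constant s" and s': "right_locally_constant s'" and less: "lexless s s'"
  shows "deviates True s s'"
proof -
  obtain b where b: "b \<in> {0..<1}" "\<And>x. x \<in> {0..<b} \<Longrightarrow> s x = s' x" "\<not> s b" "s' b"
    using less unfolding lexless_def by blast
  obtain e where e: "0 < e" "\<And>y. b \<le> y \<Longrightarrow> y < b + e \<Longrightarrow> \<not> s y"
    using right_locally_constantD[OF s, of b] b by auto
  obtain e' where e': "0 < e'" "\<And>y. b \<le> y \<Longrightarrow> y < b + e' \<Longrightarrow> s' y"
    using right_locally_constantD[OF s', of b] b by auto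
  obtain p where p: "p \<in> unit_rats" "b \<le> p" "p < b + min e e'"
    using unit_rats_between[of b "min e e'"] b(1) e e' by auto
  show ?thesis
    unfolding deviates_def
  proof (intro bexI[of _ p] conjI ballI impI)
    show "s' p = True" "s p \<noteq> True"
      using p e e' by auto
    fix r assume r: "r \<in> unit_rats" "\<exists>y\<in>{r..p}. s' y \<noteq> True"
    then obtain y where "r \<le> y" "y \<le> p" "\<not> s' y"
      by auto
    then have "r < b"
      using e'(2)[of y] p(3) by (cases "b \<le> y") auto
    then show "s r = s' r"
      using b(2)[of r] r(1) by auto
  qed fact
qed

section \<open>Cantor schemes in uncountable Polish spaces\<close>

lemma uncountable_closed_split:
  fixes S :: "'x::{metric_space, second_countable_topology} set"
  assumes "closed S" "uncountable S" "0 < e"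
  shows "\<exists>S0 S1. S0 \<subseteq> S \<and> S1 \<subseteq> S \<and> closed S0 \<and> closed S1 \<and> uncountable S0 \<and> uncountable S1 \<and>
    S0 \<inter> S1 = {} \<and> (\<forall>x\<in>S0. \<forall>y\<in>S0. dist x y < e) \<and> (\<forall>x\<in>S1. \<forall>y\<in>S1. dist x y < e)"
proof -
  \<comment> \<open>These are the condensation points of \<open>S\<close>. By a countable base all
    but countably many points of \<open>S\<close> are of this kind, so there are two distinct ones;
    small closed balls around them do the splitting.\<close>
  define T where "T = {x\<in>S. \<forall>r>0. uncountable (S \<inter> cball x r)}"
  obtain \<B> :: "'x set set" where \<B>: "countable \<B>" "topological_basis \<B>"
    using ex_countable_basis by blast
  have "S - T \<subseteq> \<Union>((\<inter>) S ` {U \<in> \<B>. countable (S \<inter> U)})"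
  proof
    fix x assume "x \<in> S - T"
    then obtain r where r: "x \<in> S" "0 < r" "countable (S \<inter> cball x r)"
      by (auto simp: T_def)
    obtain U where U: "U \<in> \<B>" "x \<in> U" "U \<subseteq> ball x r"
      using topological_basisE[OF \<B>(2), of "ball x r" x] r by auto
    have "countable (S \<inter> U)"
      by (rule countable_subset[OF _ r(3)]) (use U in auto)
    then show "x \<in> \<Union>((\<inter>) S ` {U \<in> \<B>. countable (S \<inter> U)})"
      using U r by blast
  qed
  moreover have "countable (\<Union>((\<inter>) S ` {U \<in> \<B>. countable (S \<inter> U)}))"
    using \<B>(1) by (intro countable_UN) auto
  ultimately have "countable (S - T)"
    by (rule countable_subset)
  then have "uncountable T"
    using assms(2) uncountable_minus_countable by (metis Diff_Diff_Int Int_absorb2 T_def mem_Collect_eq subsetI inf.commute)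
  then have "infinite T"
    using countable_finite by blast
  then obtain x y where xy: "x \<in> T" "y \<in> T" "x \<noteq> y"
    by (metis finite.simps finite_subset insertI1 subsetI singletonD singletonI)
  define d where "d = min e (dist x y) / 4"
  have d: "0 < d" "4 * d \<le> e" "4 * d \<le> dist x y"
    using xy assms by (auto simp: d_def)
  have small: "dist a b < e" if "a \<in> S \<inter> cball c d" "b \<in> S \<inter> cball c d" for a b c
    using that d dist_triangle2[of a b c] by (auto simp: dist_commute)
  have disj: "a \<notin> cball y d" if "a \<in> cball x d" for a
    using that d dist_triangle2[of x y a] by (auto simp: dist_commute)
  show ?thesis
  proof (intro exI conjI ballI)
    show "S \<inter> cball x d \<inter> (S \<inter> cball y d) = {}"
      using disj by auto
    show "uncountable (S \<inter> cball x d)" "uncountable (S \<inter> cball y d)"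
      using xy d by (auto simp: T_def)
  qed (use assms(1) small in auto)
qed

text \<open>
  A Cantor scheme collapsed to the two halves of each of its levels. Every 0-1 sequence is realised
  by a point, which is all that is needed of an embedded Cantor set.
\<close>

lemma independent_closed_pairs:
  assumes "uncountable (UNIV :: 'x::polish_space set)"
  obtains P N :: "nat \<Rightarrow> 'x::polish_space set" where
    "\<And>n. closed (P n)" "\<And>n. closed (N n)" "\<And>n. P n \<inter> N n = {}"
    "\<And>z. \<exists>x. \<forall>n. x \<in> (if z n then P n else N n)"
proof -
  define good :: "'x set \<Rightarrow> real \<Rightarrow> (bool \<Rightarrow> 'x set) \<Rightarrow> bool" where
    "good S e g \<longleftrightarrow> (\<forall>b. g b \<subseteq> S \<and> closed (g b) \<and> uncountable (g b) \<and> (\<forall>x\<in>g b. \<forall>y\<in>g b. dist x y < e)) \<and>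
       g False \<inter> g True = {}" for S e g
  have "\<exists>g. good S e g" if S: "closed S" "uncountable S" "0 < e" for S e
  proof -
    obtain S0 S1 where "S0 \<subseteq> S" "S1 \<subseteq> S" "closed S0" "closed S1" "uncountable S0" "uncountable S1"
      "S0 \<inter> S1 = {}" "\<forall>x\<in>S0. \<forall>y\<in>S0. dist x y < e" "\<forall>x\<in>S1. \<forall>y\<in>S1. dist x y < e"
      using uncountable_closed_split[OF S] by (elim exE conjE) (rule that; assumption)
    then show ?thesis
      by (intro exI[of _ "\<lambda>b. if b then S1 else S0"]) (auto simp: good_def)
  qed
  then obtain g where g: "\<And>S e. closed S \<Longrightarrow> uncountable S \<Longrightarrow> 0 < e \<Longrightarrow> good S e (g S e)"
    by metis
  \<comment> \<open>The list grows at its head, so the branch along \<open>z\<close> runs through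
    reversed prefixes of \<open>z\<close>.\<close>
  define C :: "bool list \<Rightarrow> 'x set" where
    "C = rec_list UNIV (\<lambda>b w S. g S (1 / real (Suc (length w))) b)"
  have C_Cons: "C (b # w) = g (C w) (1 / real (Suc (length w))) b" for b w
    by (simp add: C_def)
  have C: "closed (C w)" "uncountable (C w)" for w
  proof (induction w)
    case Nil
    { case 1 show ?case by (simp add: C_def) }
    { case 2 show ?case using assms by (simp add: C_def) }
  next
    case (Cons b w)
    then have "good (C w) (1 / real (Suc (length w))) (g (C w) (1 / real (Suc (length w))))"
      by (intro g) auto
    then show "closed (C (b # w))" "uncountable (C (b # w))"
      by (auto simp: C_Cons good_def)
  qed
  have good: "good (C w) (1 / real (Suc (length w))) (\<lambda>b. C (b # w))" for w
    using g[of "C w" "1 / real (Suc (length w))"] C by (simp add: C_Cons)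
  have sub: "C (b # w) \<subseteq> C w" for b w
    using good unfolding good_def by blast
  have small: "dist x y < 1 / real (Suc (length w))" if "x \<in> C (b # w)" "y \<in> C (b # w)" for x y b w
    using good[of w] that unfolding good_def by blast
  have disj: "C v \<inter> C w = {}" if "length v = length w" "v \<noteq> w" for v w
    using that
  proof (induction v w rule: list_induct2)
    case (Cons a v b w)
    show ?case
    proof (cases "v = w")
      case True
      then show ?thesis
        using Cons(3) good[of w] by (cases a; cases b) (auto simp: good_def)
    next
      case False
      then show ?thesis
        using Cons(2) sub[of a v] sub[of b w] by blast
    qed
  qed simp
  \<comment> \<open>The pieces of level \<open>n + 1\<close> whose last chosen digit is
    \<open>b\<close>: finitely many closed sets, hence a closed union.\<close>
  define H where "H b n = \<Union>(C ` (Cons b ` {w. length w = n}))" for b n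
  have fin: "finite {w :: bool list. length w = n}" for n
    using finite_lists_length_eq[of "UNIV :: bool set" n] by simp
  show thesis
  proof (rule that[of "H True" "H False"])
    show "closed (H True n)" "closed (H False n)" for n
      unfolding H_def using fin C by (auto intro!: closed_Union)
    have "C (True # v) \<inter> C (False # w) = {}" if "length v = n" "length w = n" for v w n
      using that by (intro disj) auto
    then show "H True n \<inter> H False n = {}" for n
      unfolding H_def by blast
    fix z :: "nat \<Rightarrow> bool"
    define w where "w n = rev (map z [0..<n])" for n
    have w_Suc: "w (Suc n) = z n # w n" and len: "length (w n) = n" for n
      by (auto simp: w_def)
    have step: "C (w (Suc n)) \<subseteq> C (w n)" "\<forall>x\<in>C (w (Suc n)). \<forall>y\<in>C (w (Suc n)). dist x y < 1 / real (Suc n)" for n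
      using sub small[of _ _ "w n"] unfolding w_Suc len by blast+
    obtain x where x: "\<And>n. x \<in> C (w n)"
    proof (rule decreasing_closed_nest[of "\<lambda>n. C (w n)"])
      show "C (w n) \<subseteq> C (w m)" if "m \<le> n" for m n
        using lift_Suc_antimono_le[of "\<lambda>n. C (w n)", OF _ that] step(1) by blast
      show "C (w n) \<noteq> {}" for n
        using C(2)[of "w n"] by auto
      show "\<exists>n. \<forall>x\<in>C (w n). \<forall>y\<in>C (w n). dist x y < \<epsilon>" if "0 < \<epsilon>" for \<epsilon>
      proof -
        obtain n where "1 / real (Suc n) < \<epsilon>"
          using nat_approx_posE[OF \<open>0 < \<epsilon>\<close>] .
        then show ?thesis
          using step(2)[of n] by (meson order_less_trans)
      qed
    qed (use C in auto)
    have "x \<in> H (z n) n" for n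
      unfolding H_def using x[of "Suc n"] len[of n] w_Suc[of n] by auto
    then show "\<exists>x. \<forall>n. x \<in> (if z n then H True n else H False n)"
      by (intro exI[of _ x]) (metis (full_types))
  qed
qed

text \<open>With \<open>E\<close> and its complement written as increasing unions of closed sets
  \<open>S n\<close> and \<open>T n\<close>, Urysohn functions that are 1 on \<open>S n\<close> and
  0 on \<open>T n\<close> are eventually constant at each point.\<close>

lemma baire_class1_indicator:
  fixes E :: "'x::metric_space set"
  assumes "fsigma_in euclidean E" "fsigma_in euclidean (- E)"
  shows "baire_class1 (indicator E :: 'x \<Rightarrow> real)"
proof -
  obtain S T where S: "\<And>n. closed (S n)" "incseq S" "(\<Union>n. S n) = E"
    and T: "\<And>n. closed (T n)" "incseq T" "(\<Union>n. T n) = - E"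
    using assms unfolding fsigma_in_ascending incseq_Suc_iff by auto
  have "\<exists>f :: 'x \<Rightarrow> real. continuous_on UNIV f \<and> f ` T n \<subseteq> {0} \<and> f ` S n \<subseteq> {1}" for n
  proof -
    have "disjnt (T n) (S n)"
      using S(3) T(3) by (auto simp: disjnt_def)
    then show ?thesis
      using Urysohn_lemma_alt[of "euclidean :: 'x topology" "T n" "S n" 0 1] S(1) T(1)
        metrizable_imp_normal_space[OF metrizable_space_euclidean]
      by (metis closed_closedin continuous_map_iff_continuous2)
  qed
  then obtain f :: "nat \<Rightarrow> 'x \<Rightarrow> real" where f: "\<And>n. continuous_on UNIV (f n)"
    "\<And>n. f n ` T n \<subseteq> {0}" "\<And>n. f n ` S n \<subseteq> {1}"
    by metis
  have "(\<lambda>n. f n x) \<longlonglongrightarrow> indicator E x" for x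
  proof -
    obtain m where m: "if x \<in> E then x \<in> S m else x \<in> T m"
      using S(3) T(3) by (metis Compl_iff UN_iff)
    have "f n x = indicator E x" if "m \<le> n" for n
    proof (cases "x \<in> E")
      case True
      then show ?thesis
        using m incseqD[OF S(2) that] f(3)[of n] by auto
    next
      case False
      then show ?thesis
        using m incseqD[OF T(2) that] f(2)[of n] by auto
    qed
    then show ?thesis
      by (intro tendsto_eventually eventually_sequentiallyI[of m])
  qed
  then show ?thesis
    unfolding baire_class1_def using f(1) by blast
qed

text \<open>A colouring \<open>s\<close> goes to the indicator of \<open>E s\<close>, the points of
  \<open>K\<close> whose code first leaves \<open>s\<close> downwards. \<open>deviates_mono\<close>
  gives monotonicity, and a point coding the smaller colouring gives strictness.\<close>

lemma order_embeds_baire1_if_colourable: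
  assumes "uncountable (UNIV :: 'x::polish_space set)" and col: "colourable r"
  shows "order_embeds r (baire1_order :: ('x \<Rightarrow> real) rel)"
proof -
  obtain P' N' :: "nat \<Rightarrow> 'x set" where PN': "\<And>n. closed (P' n)" "\<And>n. closed (N' n)" "\<And>n. P' n \<inter> N' n = {}"
    "\<And>z. \<exists>x. \<forall>n. x \<in> (if z n then P' n else N' n)"
    using independent_closed_pairs[OF assms(1)] by metis
  define P N where "P q = P' (to_nat_on \<rat> q)" and "N q = N' (to_nat_on \<rat> q)" for q :: real
  have PN: "closed (P q)" "closed (N q)" "P q \<inter> N q = {}" for q
    by (simp_all add: P_def N_def PN')
  have branch: "\<exists>x. \<forall>q\<in>\<rat>. x \<in> (if z q then P q else N q)" for z
    using PN'(4)[of "\<lambda>n. z (from_nat_into \<rat> n)"] countable_rat unfolding P_def N_def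
    by (metis from_nat_into_to_nat_on)
  \<comment> \<open>On \<open>K\<close> each rational of [0, 1) has exactly one side, so both
    possible values of the code at \<open>q\<close> are closed conditions.\<close>
  define K where "K = (\<Inter>q\<in>unit_rats. P q \<union> N q)"
  have K: "closed K"
    unfolding K_def by (intro closed_INT ballI closed_Un PN)
  define side where "side c q = (if c then P q else N q)" for c q
  have closed_side: "closed (side c q)" for c q
    by (simp add: side_def PN)
  define code where "code x q \<longleftrightarrow> x \<in> P q" for x q
  have side: "x \<in> side c q \<longleftrightarrow> code x q = c" if "x \<in> K" "q \<in> unit_rats" for x c q
    using that PN(3)[of q] unfolding K_def code_def side_def by (cases c) auto
  define E where "E s = {x \<in> K. deviates True (code x) s}" for s
  \<comment> \<open>For a fixed witness \<open>q\<close>, \<open>deviates\<close> becomes an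
    intersection of closed sets; the union over the countably many \<open>q\<close> is
    F-sigma.\<close>
  define piece where "piece c s q =
      (if s q = c then K \<inter> side (\<not> c) q \<inter>
         (\<Inter>p\<in>{p\<in>unit_rats. p < q \<and> (\<exists>y\<in>{p..q}. s y \<noteq> c)}. side (s p) p) else {})" for c s q
  have closed_piece: "closed (piece c s q)" for c s q
    unfolding piece_def using K closed_side by (auto intro!: closed_Int closed_INT)
  have piece: "(\<Union>q\<in>unit_rats. piece c s q) = {x \<in> K. deviates c (code x) s}" for c s
  proof -
    have "x \<in> piece c s q \<longleftrightarrow> x \<in> K \<and> s q = c \<and> code x q \<noteq> c \<and>
        (\<forall>p\<in>unit_rats. p < q \<longrightarrow> (\<exists>y\<in>{p..q}. s y \<noteq> c) \<longrightarrow> code x p = s p)"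
      if "q \<in> unit_rats" for x q
    proof (cases "x \<in> K \<and> s q = c")
      case True
      then show ?thesis
        using side[of x q "\<not> c"] side[of x] that unfolding piece_def by auto
    qed (auto simp: piece_def)
    then show ?thesis
      unfolding deviates_def by blast
  qed
  have baire: "baire_class1 (indicator (E s) :: 'x \<Rightarrow> real)" if s: "right_locally_constant s" for s
  proof -
    define rest where "rest = K \<inter> (\<Inter>q\<in>unit_rats. side (s q) q)"
    have closed_rest: "closed rest"
      unfolding rest_def using K closed_side by (intro closed_Int closed_INT) auto
    have rest: "rest = {x \<in> K. \<forall>q\<in>unit_rats. code x q = s q}"
      unfolding rest_def using side by auto
    have pieces: "fsigma_in euclidean {x \<in> K. deviates c (code x) s}" for c
      unfolding piece[symmetric]
      using closed_piece countable_rat by (intro fsigma_in_Union) (auto intro: closed_imp_fsigma_in)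
    \<comment> \<open>By \<open>deviates_exclusive\<close> and \<open>deviates_total\<close>, a
      point of \<open>K\<close> outside \<open>E s\<close> either codes \<open>s\<close> on the
      rationals of [0, 1) or first leaves \<open>s\<close> upwards.\<close>
    have "- E s = rest \<union> - K \<union> {x \<in> K. deviates False (code x) s}"
    proof -
      have "x \<in> rest \<or> deviates False (code x) s \<longleftrightarrow> \<not> deviates True (code x) s" if "x \<in> K" for x
        using deviates_exclusive[of "code x" s] deviates_total[OF s, of _ "code x"] that
          not_deviates_if_agree[of "code x" s True]
        unfolding rest by blast
      then show ?thesis
        unfolding E_def rest by auto
    qed
    moreover have "fsigma_in euclidean (- K)"
      using K by (intro open_imp_fsigma_in metrizable_space_euclidean) auto
    ultimately have "fsigma_in euclidean (- E s)"
      using pieces closed_rest by (simp add: fsigma_in_Un closed_imp_fsigma_in)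
    then show ?thesis
      using pieces[of True] by (intro baire_class1_indicator) (auto simp: E_def)
  qed
  obtain \<Phi> where \<Phi>: "\<And>p. p \<in> Field r \<Longrightarrow> right_locally_constant (\<Phi> p)"
    "\<And>p q. (p, q) \<in> r - Id \<Longrightarrow> lexless (\<Phi> p) (\<Phi> q)"
    using col unfolding colourable_def by metis
  show ?thesis
    unfolding order_embeds_def
  proof (intro exI[of _ "\<lambda>p. indicator (E (\<Phi> p))"] conjI allI impI)
    show "(\<lambda>p. indicator (E (\<Phi> p))) ` Field r \<subseteq> Field (baire1_order :: ('x \<Rightarrow> real) rel)"
      using baire \<Phi>(1) by (auto simp: Field_baire1_order)
    fix p q assume pq: "(p, q) \<in> r - Id"
    then have "p \<in> Field r" "q \<in> Field r"
      by (auto intro: FieldI1 FieldI2)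
    then have rlc: "right_locally_constant (\<Phi> p)" "right_locally_constant (\<Phi> q)"
      using \<Phi>(1) by auto
    have less: "lexless (\<Phi> p) (\<Phi> q)"
      using \<Phi>(2) pq .
    have sub: "E (\<Phi> p) \<subseteq> E (\<Phi> q)"
      unfolding E_def using deviates_mono[OF rlc less] by blast
    obtain x where x: "\<And>u. u \<in> \<rat> \<Longrightarrow> x \<in> side (\<Phi> p u) u"
      using branch unfolding side_def by blast
    have "x \<in> P u \<union> N u" if "u \<in> unit_rats" for u
      using x[of u] that by (cases "\<Phi> p u") (auto simp: side_def)
    then have "x \<in> K"
      unfolding K_def by blast
    have code: "code x u = \<Phi> p u" if "u \<in> unit_rats" for u
      using x[of u] side[OF \<open>x \<in> K\<close> that] that by auto
    then have "x \<in> E (\<Phi> q)" "x \<notin> E (\<Phi> p)"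
      using deviates_lexless[OF rlc less] \<open>x \<in> K\<close> unfolding E_def deviates_def by auto
    then have "(indicator (E (\<Phi> p)) :: 'x \<Rightarrow> real) \<noteq> indicator (E (\<Phi> q))"
      by (metis indicator_eq_1_iff)
    then show "(indicator (E (\<Phi> p)), indicator (E (\<Phi> q))) \<in> (baire1_order :: ('x \<Rightarrow> real) rel) - Id"
      using sub baire rlc unfolding strict_baire1_order by (auto simp: le_fun_def indicator_def)
  qed
qed

section \<open>Towers of closed sets\<close>

text \<open>Both traces are taken in one operator, so that a tower is generated by a single
  shrinking map on closed sets. The intermediate set \<open>closure (A \<inter> F)\<close> returns
  in \<open>colour\<close>.\<close>

definition alternate :: "'x::topological_space set \<Rightarrow> 'x set \<Rightarrow> 'x set \<Rightarrow> 'x set" where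
  "alternate A B F = closure (B \<inter> closure (A \<inter> F))"

text \<open>Closure under intersections replaces transfinite recursion; the empty family puts
  \<open>UNIV\<close> into the tower as its starting set.\<close>

inductive_set tower :: "'x::topological_space set \<Rightarrow> 'x set \<Rightarrow> 'x set set" for A B where
  Inter: "\<forall>C\<in>\<C>. C \<in> tower A B \<Longrightarrow> \<Inter>\<C> \<in> tower A B"
| step: "F \<in> tower A B \<Longrightarrow> alternate A B F \<in> tower A B"

lemma closure_Int_subset: "closed F \<Longrightarrow> closure (A \<inter> F) \<subseteq> F"
  by (simp add: closure_minimal)

lemma alternate_subset_closure: "alternate A B F \<subseteq> closure (A \<inter> F)"
  by (simp add: alternate_def closure_minimal)

lemma closed_tower: "F \<in> tower A B \<Longrightarrow> closed F"
  by (induction rule: tower.induct) (auto simp: alternate_def)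

lemma alternate_subset: "closed F \<Longrightarrow> alternate A B F \<subseteq> F"
  using alternate_subset_closure closure_Int_subset by blast

text \<open>First half of a chain argument of Bourbaki-Witt type: if no step from a strictly larger
  element jumps over \<open>F\<close>, then \<open>F\<close> is comparable with everything and
  nothing lies strictly between \<open>F\<close> and its successor.\<close>

lemma tower_comparable_normal:
  assumes F: "F \<in> tower A B"
    and normal: "\<And>H. H \<in> tower A B \<Longrightarrow> F \<subset> H \<Longrightarrow> F \<subseteq> alternate A B H"
    and H: "H \<in> tower A B"
  shows "F \<subseteq> H \<or> H \<subseteq> alternate A B F"
  using H
proof (induction rule: tower.induct)
  case (Inter \<C>)
  then show ?case by blast
next
  case (step H)
  then show ?case
    using normal[OF step(1)] alternate_subset[OF closed_tower[OF step(1)], of A B] by blast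
qed

text \<open>Second half: by induction every element has this property. At an intersection, the
  property of one member \<open>C\<close> that does not contain \<open>H\<close> suffices.\<close>

lemma tower_normal:
  assumes "F \<in> tower A B"
  shows "H \<in> tower A B \<Longrightarrow> F \<subset> H \<Longrightarrow> F \<subseteq> alternate A B H"
  using assms
proof (induction arbitrary: H rule: tower.induct)
  case (Inter \<C>)
  then obtain C where C: "C \<in> \<C>" "\<not> H \<subseteq> C"
    by blast
  then have "C \<subseteq> H \<or> H \<subseteq> alternate A B C"
    using Inter tower_comparable_normal[of C A B H] by blast
  then have "C \<subset> H"
    using C alternate_subset[OF closed_tower, of C A B A B] Inter by blast
  then show ?case
    using Inter C by blast
next
  case (step F)
  have "F \<subseteq> H \<or> H \<subseteq> alternate A B F"
    using step tower_comparable_normal[of F A B H] by blast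
  then have "F \<subseteq> H"
    using step by blast
  then show ?case
    using step alternate_subset[OF closed_tower, of F A B A B] by blast
qed

lemma tower_comparable:
  assumes "F \<in> tower A B" "H \<in> tower A B"
  shows "F \<subseteq> H \<or> H \<subseteq> alternate A B F"
  using tower_comparable_normal tower_normal assms by blast

text \<open>The least element of a tower is a fixed point of \<open>alternate\<close>, so this
  condition makes the tower descend to the empty set. For level sets it will come from the Baire
  category theorem.\<close>

locale exhausting =
  fixes A B :: "'x::topological_space set"
  assumes fixpoint_empty: "closed F \<Longrightarrow> alternate A B F = F \<Longrightarrow> F = {}"
begin

text \<open>Reverse inclusion well-orders the tower. If the least tower element \<open>I\<close>
  above \<open>S\<close> were not in \<open>S\<close>, all of \<open>S\<close> would lie in
  \<open>alternate A B I\<close>; by minimality \<open>I\<close> would be a fixed point, hence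
  empty, and then \<open>S\<close> could contain nothing but \<open>I\<close>.\<close>

lemma tower_greatest:
  assumes "S \<subseteq> tower A B" "S \<noteq> {}"
  obtains F where "F \<in> S" "\<And>H. H \<in> S \<Longrightarrow> H \<subseteq> F"
proof -
  define I where "I = \<Inter>{F \<in> tower A B. \<forall>H\<in>S. H \<subseteq> F}"
  have I: "I \<in> tower A B"
    unfolding I_def by (rule tower.Inter) auto
  have upper: "H \<subseteq> I" if "H \<in> S" for H
    using that unfolding I_def by blast
  have "I \<in> S"
  proof (rule ccontr)
    assume "I \<notin> S"
    have "H \<subseteq> alternate A B I" if "H \<in> S" for H
    proof -
      have "H \<noteq> I" "H \<subseteq> I" "I \<subseteq> H \<or> H \<subseteq> alternate A B I"
        using that \<open>I \<notin> S\<close> upper tower_comparable[OF I] assms(1) by auto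
      then show ?thesis by blast
    qed
    then have "I \<subseteq> alternate A B I"
      using tower.step[OF I] unfolding I_def by blast
    then have "I = {}"
      using fixpoint_empty closed_tower[OF I] alternate_subset by blast
    then show False
      using upper assms \<open>I \<notin> S\<close> by auto
  qed
  then show thesis
    using that upper by blast
qed

lemma empty_if_self_closure:
  assumes "closed F" "closure (A \<inter> F) = F" "closure (B \<inter> F) = F"
  shows "F = {}"
  using assms by (intro fixpoint_empty) (auto simp: alternate_def)

end

text \<open>
  The common initial segment of the towers of \<open>(A, B)\<close> and \<open>(A', B')\<close>; its least element, the
  \<open>split_set\<close> below, is where the two towers part.
\<close>

inductive_set common_tower :: "'x::topological_space set \<Rightarrow> 'x set \<Rightarrow> 'x set \<Rightarrow> 'x set \<Rightarrow> 'x set set"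
  for A B A' B' where
  Inter: "\<forall>C\<in>\<C>. C \<in> common_tower A B A' B' \<Longrightarrow> \<Inter>\<C> \<in> common_tower A B A' B'"
| step: "F \<in> common_tower A B A' B' \<Longrightarrow> closure (A \<inter> F) = closure (A' \<inter> F) \<Longrightarrow>
    alternate A B F = alternate A' B' F \<Longrightarrow> alternate A B F \<in> common_tower A B A' B'"

lemma common_tower_commute: "common_tower A B A' B' = common_tower A' B' A B"
proof -
  have "F \<in> common_tower A' B' A B" if "F \<in> common_tower A B A' B'" for F and A B A' B' :: "'a set"
    using that
  proof (induction rule: common_tower.induct)
    case (step F)
    then show ?case
      using common_tower.step[of F A' B' A B] by simp
  qed (auto intro: common_tower.Inter)
  then show ?thesis by blast
qed

lemma common_tower_subset: "common_tower A B A' B' \<subseteq> tower A B"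
proof
  show "F \<in> tower A B" if "F \<in> common_tower A B A' B'" for F
    using that by (induction rule: common_tower.induct) (blast intro: tower.intros)+
qed

definition split_set :: "'x::topological_space set \<Rightarrow> 'x set \<Rightarrow> 'x set \<Rightarrow> 'x set \<Rightarrow> 'x set" where
  "split_set A B A' B' = \<Inter>(common_tower A B A' B')"

lemma split_set_commute: "split_set A B A' B' = split_set A' B' A B"
  by (metis split_set_def common_tower_commute)

lemma split_set_in: "split_set A B A' B' \<in> common_tower A B A' B'"
  unfolding split_set_def by (auto intro: common_tower.Inter)

lemma split_set_subset: "F \<in> common_tower A B A' B' \<Longrightarrow> split_set A B A' B' \<subseteq> F"
  unfolding split_set_def by blast

text \<open>If a half step from \<open>F\<close> differs between the towers, no common step starts
  at \<open>F\<close>; by \<open>tower_normal\<close> none jumps over \<open>F\<close> either, so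
  \<open>F\<close> is the least common element.\<close>

lemma common_step:
  assumes F: "F \<in> common_tower A B A' B'" "F \<noteq> split_set A B A' B'"
  shows "closure (A \<inter> F) = closure (A' \<inter> F)" "alternate A B F = alternate A' B' F"
    "alternate A B F \<in> common_tower A B A' B'"
proof -
  have "closure (A \<inter> F) = closure (A' \<inter> F) \<and> alternate A B F = alternate A' B' F"
  proof (rule ccontr)
    assume distinct: "\<not> (closure (A \<inter> F) = closure (A' \<inter> F) \<and> alternate A B F = alternate A' B' F)"
    have "F \<subseteq> H" if "H \<in> common_tower A B A' B'" for H
      using that
    proof (induction rule: common_tower.induct)
      case (step H)
      then have "F \<noteq> H"
        using distinct by blast
      moreover have "F \<in> tower A B" "H \<in> tower A B"
        using F step common_tower_subset by blast+
      ultimately show ?case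
        using tower_normal[of F A B H] step by blast
    qed blast
    then show False
      using F unfolding split_set_def by blast
  qed
  then show "closure (A \<inter> F) = closure (A' \<inter> F)" "alternate A B F = alternate A' B' F"
    "alternate A B F \<in> common_tower A B A' B'"
    using F common_tower.step by blast+
qed

lemma tower_beyond_split:
  assumes "H \<in> tower A B"
  shows "H \<in> common_tower A B A' B' \<or> H \<subseteq> alternate A B (split_set A B A' B')"
  using assms
proof (induction rule: tower.induct)
  case (Inter \<C>)
  then show ?case
    by (metis Inter_lower common_tower.Inter order_trans)
next
  case (step H)
  then show ?case
    using common_step(3)[of H A B A' B'] alternate_subset[OF closed_tower[OF step(1)], of A B]
    by (metis order_trans order_refl)
qed

section \<open>Colourings read off towers, and their monotonicity\<close>

locale strictly_antitone_on_closed =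
  fixes u :: "'x::topological_space set \<Rightarrow> real"
  assumes strict: "closed F \<Longrightarrow> closed H \<Longrightarrow> F \<subset> H \<Longrightarrow> u H < u F"
    and u_empty: "u {} = 1"
    and u_nonneg: "0 \<le> u F"
begin

lemma antitone: "closed F \<Longrightarrow> closed H \<Longrightarrow> F \<subseteq> H \<Longrightarrow> u H \<le> u F"
  using strict by (metis less_eq_real_def psubsetI)

lemma u_less_1: "closed F \<Longrightarrow> F \<noteq> {} \<Longrightarrow> u F < 1"
  using strict[of "{}" F] u_empty by auto

text \<open>
  The complement of the colour class consists of the intervals from \<open>u F\<close> to \<open>u (closure (A \<inter> F))\<close>
  and of the gaps below \<open>u F\<close> at limits \<open>F\<close>, since \<open>u\<close> need not be continuous along intersections.
\<close>

definition colour :: "'x set \<Rightarrow> 'x set \<Rightarrow> real \<Rightarrow> bool" where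
  "colour A B x \<longleftrightarrow> (\<exists>F\<in>tower A B. u (closure (A \<inter> F)) \<le> x \<and> x < u (alternate A B F))"

text \<open>Let \<open>F1\<close> be the greatest tower element with \<open>x < u F1\<close>; it
  exists because the tower reaches the empty set. On [x, u F1) only a step from some
  \<open>F\<close> strictly above \<open>F1\<close> into \<open>F1\<close> can matter. There is at
  most one, so the colour changes at most once there, at
  \<open>u (closure (A \<inter> F))\<close>.\<close>

lemma right_locally_constant_colour:
  assumes "exhausting A B"
  shows "right_locally_constant (colour A B)"
  unfolding right_locally_constant_def
proof
  interpret exhausting A B by fact
  fix x :: real
  assume x: "x \<in> {0..<1}"
  define N where "N = {F \<in> tower A B. x < u F}"
  define Z where "Z = \<Inter>(tower A B)"
  have Z: "Z \<in> tower A B"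
    unfolding Z_def by (rule tower.Inter) simp
  then have "Z \<subseteq> alternate A B Z"
    using tower.step[OF Z] unfolding Z_def by blast
  then have "Z = {}"
    using fixpoint_empty closed_tower[OF Z] alternate_subset by blast
  then have "{} \<in> N"
    using Z x u_empty by (auto simp: N_def)
  then obtain F1 where F1: "F1 \<in> N" "\<And>H. H \<in> N \<Longrightarrow> H \<subseteq> F1"
    using tower_greatest[of N] by (auto simp: N_def)
  have cl: "closed (closure (A \<inter> F))" "closed (alternate A B F)" for F
    by (auto simp: alternate_def)
  have relevant: "F \<in> tower A B \<and> F1 \<subset> F \<and> alternate A B F \<subseteq> F1"
    if F: "F \<in> tower A B" "u (closure (A \<inter> F)) \<le> y" "y < u (alternate A B F)"
      and y: "x \<le> y" "y < u F1" for F y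
  proof -
    have "u F \<le> y"
      using F antitone[OF cl(1) closed_tower[OF F(1)] closure_Int_subset] closed_tower[OF F(1)] by (metis order_trans)
    then have "\<not> F \<subseteq> F1"
      using antitone[of F F1] y closed_tower F(1) F1(1) unfolding N_def by fastforce
    moreover have "alternate A B F \<subseteq> F1"
      using F1(2)[of "alternate A B F"] F y tower.step unfolding N_def by force
    moreover have "F1 \<subseteq> F"
      using tower_comparable[of F1 A B F] F(1) F1(1) calculation(1)
        alternate_subset[OF closed_tower, of F1 A B A B] unfolding N_def by blast
    ultimately show ?thesis
      using F by blast
  qed
  show "\<exists>e>0. \<forall>y\<in>{x..<x + e}. colour A B y = colour A B x"
  proof (cases "\<exists>F\<in>tower A B. F1 \<subset> F \<and> alternate A B F \<subseteq> F1")
    case False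
    then have "\<not> colour A B y" if "x \<le> y" "y < u F1" for y
      using relevant that unfolding colour_def by blast
    moreover have "x < u F1"
      using F1(1) by (simp add: N_def)
    ultimately show ?thesis
      by (intro exI[of _ "u F1 - x"]) auto
  next
    case True
    then obtain F where F: "F \<in> tower A B" "F1 \<subset> F" "alternate A B F \<subseteq> F1"
      by blast
    have "H = F" if H: "H \<in> tower A B" "F1 \<subset> H" "alternate A B H \<subseteq> F1" for H
      using tower_normal[of F A B H] tower_normal[of H A B F] tower_comparable[of F A B H]
        alternate_subset[OF closed_tower, of F A B A B] F H by blast
    then have eq: "colour A B y \<longleftrightarrow> u (closure (A \<inter> F)) \<le> y" if "x \<le> y" "y < u F1" for y
      using that relevant[of _ y] F(1) antitone[OF cl(2) closed_tower F(3)] F1(1)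
      unfolding colour_def N_def by (smt (verit) mem_Collect_eq)
    have x1: "x < u F1"
      using F1(1) by (simp add: N_def)
    show ?thesis
    proof (cases "u (closure (A \<inter> F)) \<le> x")
      case True
      then show ?thesis
        using eq x1 by (intro exI[of _ "u F1 - x"]) auto
    next
      case False
      then show ?thesis
        using eq x1 by (intro exI[of _ "min (u F1) (u (closure (A \<inter> F))) - x"]) auto
    qed
  qed
qed

text \<open>A witness \<open>F\<close> beyond the split would only colour points from
  \<open>b\<close> on, and \<open>F\<close> is not the split set itself; so both half steps from
  \<open>F\<close> are shared by the towers.\<close>

lemma colour_before_split:
  assumes b: "b \<le> u (alternate A B (split_set A B A' B'))"
    and x: "x < b" "\<not> u (closure (A \<inter> split_set A B A' B')) \<le> x"
    and col: "colour A B x"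
  shows "colour A' B' x"
proof -
  obtain F where F: "F \<in> tower A B" "u (closure (A \<inter> F)) \<le> x" "x < u (alternate A B F)"
    using col unfolding colour_def by blast
  have "\<not> F \<subseteq> alternate A B (split_set A B A' B')"
  proof
    assume "F \<subseteq> alternate A B (split_set A B A' B')"
    then have "closure (A \<inter> F) \<subseteq> alternate A B (split_set A B A' B')"
      using closure_Int_subset[OF closed_tower[OF F(1)]] by blast
    then show False
      using antitone[of "closure (A \<inter> F)" "alternate A B (split_set A B A' B')"] b x F
      by (auto simp: alternate_def)
  qed
  then have C: "F \<in> common_tower A B A' B'"
    using tower_beyond_split F(1) by blast
  have ne: "F \<noteq> split_set A B A' B'"
    using F x by blast
  have "F \<in> tower A' B'"
    using C common_tower_commute common_tower_subset by blast
  then show ?thesis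
    using F(2,3) common_step[OF C ne] unfolding colour_def by auto
qed

text \<open>Intervals of steps before the split end by \<open>b\<close>, the step at the split is
  excluded by \<open>at\<close>, and later steps start at
  \<open>u (alternate A B (split_set A B A' B'))\<close> or beyond. In the first alternative that is
  past \<open>b\<close>. In the second, a step starting exactly at \<open>b\<close> would make
  \<open>A\<close> and \<open>B\<close> both dense in the nonempty closed set
  \<open>alternate A B (split_set A B A' B')\<close>, against exhaustion.\<close>

lemma not_colour_at_split:
  assumes ex: "exhausting A B"
    and b: "u (split_set A B A' B') \<le> b"
    and ne: "b = u D \<and> alternate A B (split_set A B A' B') \<subset> D \<or>
       b = u (alternate A B (split_set A B A' B')) \<and> alternate A B (split_set A B A' B') \<noteq> {}"
    and D: "closed D"
    and at: "\<not> (u (closure (A \<inter> split_set A B A' B')) \<le> b \<and> b < u (alternate A B (split_set A B A' B')))"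
  shows "\<not> colour A B b"
proof
  interpret exhausting A B by fact
  let ?S = "split_set A B A' B'"
  assume "colour A B b"
  then obtain F where F: "F \<in> tower A B" "u (closure (A \<inter> F)) \<le> b" "b < u (alternate A B F)"
    unfolding colour_def by blast
  have cl: "closed (closure (A \<inter> F))" "closed (alternate A B F)" for F
    by (auto simp: alternate_def)
  have S: "?S \<in> common_tower A B A' B'" "closed ?S"
    using split_set_in closed_tower common_tower_subset by blast+
  have GF: "closure (A \<inter> F) \<subseteq> F"
    using F(1) closed_tower closure_Int_subset by blast
  from tower_beyond_split[OF F(1), of A' B'] show False
  proof
    assume C: "F \<in> common_tower A B A' B'"
    show False
    proof (cases "F = ?S")
      case True
      then show False using at F by blast
    next
      case False
      then have "?S \<subseteq> alternate A B F"
        using common_step(3)[OF C False] split_set_subset by blast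
      then show False
        using antitone[OF S(2) cl(2)] F b by force
    qed
  next
    assume sub: "F \<subseteq> alternate A B ?S"
    have le: "u (alternate A B ?S) \<le> u (closure (A \<inter> F))"
      using antitone[OF cl(1) cl(2)] GF sub by blast
    from ne show False
    proof
      assume "b = u D \<and> alternate A B ?S \<subset> D"
      then show False
        using strict[OF cl(2) D] le F(2) by force
    next
      assume *: "b = u (alternate A B ?S) \<and> alternate A B ?S \<noteq> {}"
      then have eq: "closure (A \<inter> F) = alternate A B ?S"
        using strict[OF cl(1) cl(2), of F ?S] GF sub F(2) by force
      then have F_eq: "F = alternate A B ?S"
        using GF sub by blast
      have "closure (B \<inter> F) = F"
      proof
        show "closure (B \<inter> F) \<subseteq> F"
          using F(1) closed_tower closure_Int_subset by blast
        have "B \<inter> closure (A \<inter> ?S) \<subseteq> F"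
          unfolding F_eq alternate_def by (rule closure_subset)
        then have "closure (B \<inter> closure (A \<inter> ?S)) \<subseteq> closure (B \<inter> F)"
          by (intro closure_mono) blast
        then show "F \<subseteq> closure (B \<inter> F)"
          unfolding F_eq alternate_def .
      qed
      then have "F = {}"
        using empty_if_self_closure F(1) closed_tower eq F_eq by metis
      then show False
        using * F_eq by blast
    qed
  qed
qed

text \<open>The towers part at \<open>?S\<close>. If the first half steps differ, the interval of
  \<open>(A', B')\<close> starts earlier, at \<open>u ?G'\<close>; if only the second ones differ,
  it ends later, and \<open>u ?D\<close> is the first difference. If \<open>?S\<close> is empty the
  colours agree; the disjointness of \<open>B\<close> and \<open>A'\<close> obtained there serves to
  force a strict increase whenever \<open>B\<close> meets \<open>A'\<close>.\<close>

lemma colour_mono: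
  assumes ex: "exhausting A B" and ex': "exhausting A' B'"
    and AA: "A \<subseteq> A'" and BB: "B' \<subseteq> B"
  shows "(\<forall>x\<in>{0..<1}. colour A B x = colour A' B' x) \<and> B \<inter> A' = {} \<or> lexless (colour A B) (colour A' B')"
proof -
  let ?S = "split_set A B A' B'"
  let ?G = "closure (A \<inter> ?S)" and ?G' = "closure (A' \<inter> ?S)"
  let ?D = "alternate A B ?S" and ?D' = "alternate A' B' ?S"
  have S: "?S \<in> common_tower A B A' B'" "?S \<in> tower A B" "?S \<in> tower A' B'" "closed ?S"
    using split_set_in closed_tower common_tower_subset common_tower_commute by blast+
  have cl: "closed ?G" "closed ?G'" "closed ?D" "closed ?D'"
    by (auto simp: alternate_def)
  have sub: "?G \<subseteq> ?G'" "?D \<subseteq> ?G" "?D' \<subseteq> ?G'" "?G \<subseteq> ?S" "?G' \<subseteq> ?S"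
    using AA closure_Int_subset[OF S(4)] alternate_subset_closure closure_mono[of "A \<inter> ?S" "A' \<inter> ?S"] by blast+
  consider "?S = {}" | "?G \<subset> ?G'" | "?S \<noteq> {}" "?G = ?G'" "?D' \<subset> ?D"
  proof -
    have "?S = {}" if "?G = ?G'" "?D = ?D'"
    proof -
      have "?S \<subseteq> ?D"
        using common_tower.step[OF S(1)] that split_set_subset by blast
      then show ?thesis
        using exhausting.fixpoint_empty[OF ex S(4)] alternate_subset[OF S(4)] by blast
    qed
    moreover have "?D' \<subseteq> ?D" if "?G = ?G'"
      unfolding alternate_def using that BB by (intro closure_mono) auto
    ultimately show thesis
      using that sub by blast
  qed
  then show ?thesis
  proof cases
    case 1
    have empty: "alternate A B {} = {}" "alternate A' B' {} = {}" "closure (A \<inter> {}) = {}" "closure (A' \<inter> {}) = {}"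
      by (auto simp: alternate_def)
    \<comment> \<open>A point of \<open>B \<inter> A'\<close> survives every common step:
      \<open>A'\<close> keeps it in the shared set \<open>closure (A \<inter> F)\<close>, and
      \<open>B\<close> in the next one.\<close>
    have "x \<in> F" if x: "x \<in> B \<inter> A'" and "F \<in> common_tower A B A' B'" for x F
      using that(2)
    proof (induction rule: common_tower.induct)
      case (step F)
      then have "x \<in> closure (A \<inter> F)"
        using x closure_subset[of "A' \<inter> F"] by auto
      then show ?case
        using x closure_subset[of "B \<inter> closure (A \<inter> F)"] unfolding alternate_def by auto
    qed blast
    then have "B \<inter> A' = {}"
      using S(1) 1 by blast
    moreover have "colour A B x = colour A' B' x" if "x \<in> {0..<1}" for x
      using colour_before_split[of 1 A B A' B' x] colour_before_split[of 1 A' B' A B x] that 1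
      by (auto simp: split_set_commute[of A'] empty u_empty)
    ultimately show ?thesis by blast
  next
    case 2
    have b: "u ?G' < u ?G" "u ?S \<le> u ?G'" "u ?G \<le> u ?D" "u ?G' \<le> u ?D'"
      using strict antitone cl S(4) sub 2 by blast+
    have "colour A B x = colour A' B' x" if "x \<in> {0..<u ?G'}" for x
      using colour_before_split[of "u ?G'" A B A' B' x] colour_before_split[of "u ?G'" A' B' A B x] that b
      by (auto simp: split_set_commute[of A'])
    moreover have "\<not> colour A B (u ?G')"
      using not_colour_at_split[OF ex, of A' B' "u ?G'" ?G'] b cl sub 2 by auto
    moreover have "colour A' B' (u ?G')"
      unfolding colour_def
    proof (intro bexI[of _ ?S] conjI)
      \<comment> \<open>Otherwise \<open>A'\<close> and \<open>B'\<close> would both be dense in the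
        nonempty \<open>?G'\<close>. Hence the interval starting at \<open>u ?G'\<close> is not
        empty.\<close>
      have "?D' \<noteq> ?G'"
      proof
        assume eq: "?D' = ?G'"
        have "closure (A' \<inter> ?G') = ?G'"
        proof
          show "closure (A' \<inter> ?G') \<subseteq> ?G'"
            by (rule closure_Int_subset) simp
          have "A' \<inter> ?S \<subseteq> ?G'"
            by (rule closure_subset)
          then show "?G' \<subseteq> closure (A' \<inter> ?G')"
            by (intro closure_mono) blast
        qed
        moreover have "closure (B' \<inter> ?G') = ?G'"
          using eq by (simp add: alternate_def)
        ultimately have "?G' = {}"
          using exhausting.empty_if_self_closure[OF ex' cl(2)] by blast
        then show False using 2 by simp
      qed
      then show "u ?G' < u ?D'"
        using strict[OF cl(4) cl(2)] sub by blast
    qed (use S in auto)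
    moreover have "u ?G' \<in> {0..<1}"
      unfolding atLeastLessThan_iff using u_nonneg u_less_1[OF cl(2)] 2 by (metis not_psubset_empty)
    ultimately show ?thesis
      unfolding lexless_def by blast
  next
    case 3
    have b: "u ?D < u ?D'" "u ?S \<le> u ?D" "u ?G \<le> u ?D"
      using strict[OF cl(4) cl(3)] antitone[OF cl(3) S(4)] antitone[OF cl(3) cl(1)] sub 3 by blast+
    have "colour A B x = colour A' B' x" if x: "x \<in> {0..<u ?D}" for x
    proof (cases "u ?G \<le> x")
      case True
      then have "colour A B x" "colour A' B' x"
        using x b S 3 unfolding colour_def by (auto intro!: bexI[of _ ?S])
      then show ?thesis by blast
    next
      case False
      then show ?thesis
        using colour_before_split[of "u ?D" A B A' B' x] colour_before_split[of "u ?D" A' B' A B x] x b 3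
        by (auto simp: split_set_commute[of A'])
    qed
    moreover have "\<not> colour A B (u ?D)"
      using not_colour_at_split[OF ex, of A' B' "u ?D" ?D] b cl 3 by auto
    moreover have "colour A' B' (u ?D)"
      using b S 3 unfolding colour_def by (auto intro!: bexI[of _ ?S])
    moreover have "u ?D \<in> {0..<1}"
      unfolding atLeastLessThan_iff using u_nonneg u_less_1[OF cl(3)] 3 by (metis not_psubset_empty)
    ultimately show ?thesis
      unfolding lexless_def by blast
  qed
qed

end

section \<open>From Baire class 1 functions to colourings\<close>

text \<open>Weigh a countable base: \<open>u F\<close> is 1 minus the total weight of the basic sets
  that meet \<open>F\<close>. A point of \<open>H - F\<close> has a basic neighbourhood missing
  \<open>F\<close>, which gives strictness.\<close>

lemma strictly_antitone_on_closed_exists: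
  obtains u :: "'x::second_countable_topology set \<Rightarrow> real" where "strictly_antitone_on_closed u"
proof -
  obtain \<B> :: "'x set set" where \<B>: "countable \<B>" "topological_basis \<B>"
    using ex_countable_basis by blast
  \<comment> \<open>Adding the empty set makes the family nonempty, as the enumeration requires, and
    adds no weight.\<close>
  define B where "B = from_nat_into (insert {} \<B>)"
  have range_B: "range B = insert {} \<B>"
    unfolding B_def using \<B>(1) by (intro range_from_nat_into) auto
  define t where "t F n = (if B n \<inter> F \<noteq> {} then (1/2::real) ^ Suc n else 0)" for F n
  have t: "0 \<le> t F n" "t F n \<le> (1/2) ^ Suc n" for F n
    by (simp_all add: t_def)
  have half: "summable (\<lambda>n. (1/2::real) ^ Suc n)" "(\<Sum>n. (1/2::real) ^ Suc n) = 1"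
    using power_half_series by (auto simp: sums_iff)
  have sum: "summable (t F)" for F
    using half(1) by (rule summable_comparison_test') (use t in auto)
  define u where "u F = 1 - suminf (t F)" for F
  have "strictly_antitone_on_closed u"
  proof
    show "u {} = 1"
      unfolding u_def t_def by simp
    show "0 \<le> u F" for F
      using suminf_le[OF t(2) sum half(1)] half(2) by (simp add: u_def)
    fix F H :: "'x set" assume FH: "closed F" "closed H" "F \<subset> H"
    then obtain x where x: "x \<in> H" "x \<in> - F"
      by blast
    obtain U where U: "U \<in> \<B>" "x \<in> U" "U \<subseteq> - F"
      using topological_basisE[OF \<B>(2), of "- F" x] x FH by auto
    obtain n where n: "B n = U"
      using U(1) range_B by (metis imageE insertI2)
    have "0 < (\<Sum>n. t H n - t F n)"
    proof (rule suminf_pos2)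
      show "summable (\<lambda>n. t H n - t F n)"
        by (intro summable_diff sum)
      show "0 \<le> t H n - t F n" for n
        using FH by (auto simp: t_def)
      show "0 < t H n - t F n"
        using n U x by (auto simp: t_def)
    qed
    then show "u H < u F"
      using suminf_diff[OF sum sum, of H F] by (simp add: u_def)
  qed
  then show thesis ..
qed

text \<open>The limit is at least \<open>c\<close> iff for all \<open>m\<close> and \<open>k\<close>
  some \<open>n \<ge> k\<close> has \<open>F n x\<close> above \<open>c - 1 / (m + 1)\<close>; for
  fixed \<open>m\<close> and \<open>k\<close> this is an open condition.\<close>

lemma baire_class1_superlevel:
  assumes "baire_class1 f"
  obtains \<U> where "countable \<U>" "\<And>U. U \<in> \<U> \<Longrightarrow> open U" "\<Inter>\<U> = {x. c \<le> f x}"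
proof -
  obtain F where F: "\<And>n. continuous_on UNIV (F n)" "\<And>x. (\<lambda>n. F n x) \<longlonglongrightarrow> f x"
    using assms unfolding baire_class1_def by blast
  define U where "U = (\<lambda>(m, k). \<Union>n\<in>{k..}. {x. c - 1 / real (Suc m) < F n x})"
  have "x \<in> \<Inter>(range U) \<longleftrightarrow> c \<le> f x" for x
  proof
    assume "c \<le> f x"
    have "\<exists>n\<ge>k. c - 1 / real (Suc m) < F n x" for m k
    proof -
      have "c - 1 / real (Suc m) < f x"
        using \<open>c \<le> f x\<close> by (smt (verit) divide_pos_pos of_nat_0_less_iff zero_less_Suc)
      then have "\<forall>\<^sub>F n in sequentially. c - 1 / real (Suc m) < F n x"
        by (rule order_tendstoD(1)[OF F(2)])
      then have "\<forall>\<^sub>F n in sequentially. k \<le> n \<and> c - 1 / real (Suc m) < F n x"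
        using eventually_ge_at_top by (rule eventually_elim2) auto
      then show ?thesis
        by (auto dest: eventually_happens)
    qed
    then show "x \<in> \<Inter>(range U)"
      by (fastforce simp: U_def)
  next
    assume x: "x \<in> \<Inter>(range U)"
    show "c \<le> f x"
    proof (rule ccontr)
      assume "\<not> c \<le> f x"
      then obtain m where m: "1 / real (Suc m) < (c - f x)"
        using nat_approx_posE[of "c - f x"] by auto
      then have "f x < c - 1 / real (Suc m)"
        by simp
      then have "\<forall>\<^sub>F n in sequentially. F n x < c - 1 / real (Suc m)"
        by (rule order_tendstoD(2)[OF F(2)])
      then obtain k where k: "\<And>n. k \<le> n \<Longrightarrow> F n x < c - 1 / real (Suc m)"
        by (auto simp: eventually_sequentially)
      have "x \<in> U (m, k)"
        using x by blast
      then show False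
        using k by (force simp: U_def)
    qed
  qed
  moreover have "open (U i)" for i
    unfolding U_def by (cases i) (auto intro!: open_UN open_Collect_less F(1))
  ultimately show thesis
    by (intro that[of "range U"]) auto
qed

lemma baire_class1_uminus: "baire_class1 f \<Longrightarrow> baire_class1 (\<lambda>x. - f x)"
proof -
  assume "baire_class1 f"
  then obtain F where "\<And>n. continuous_on UNIV (F n)" "\<And>x. (\<lambda>n. F n x) \<longlonglongrightarrow> f x"
    unfolding baire_class1_def by blast
  then show ?thesis
    unfolding baire_class1_def
    by (intro exI[of _ "\<lambda>n x. - F n x"]) (auto intro: continuous_on_minus tendsto_minus)
qed

text \<open>
  If \<open>alternate A B F = F\<close>, then \<open>A\<close> and \<open>B\<close> are disjoint G-delta sets that are both dense
  in \<open>F\<close>, so the Baire category theorem makes \<open>F\<close> empty.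
\<close>

lemma exhausting_level_sets:
  fixes f :: "'x::polish_space \<Rightarrow> real"
  assumes f: "baire_class1 f" and "p < q"
  shows "exhausting {x. q \<le> f x} {x. f x \<le> p}"
proof
  let ?A = "{x. q \<le> f x}" and ?B = "{x. f x \<le> p}"
  fix F assume F: "closed F" "alternate ?A ?B F = F"
  have A: "closure (?A \<inter> F) = F"
    using closure_Int_subset[OF F(1)] alternate_subset_closure[of ?A ?B F] F(2) by blast
  then have B: "closure (?B \<inter> F) = F"
    using F(2) by (simp add: alternate_def)
  obtain \<U> where \<U>: "countable \<U>" "\<And>U. U \<in> \<U> \<Longrightarrow> open U" "\<Inter>\<U> = ?A"
    using baire_class1_superlevel[OF f] by metis
  obtain \<V> where \<V>: "countable \<V>" "\<And>U. U \<in> \<V> \<Longrightarrow> open U" "\<Inter>\<V> = ?B"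
    using baire_class1_superlevel[OF baire_class1_uminus[OF f], of "- p"] by auto
  have dense: "closure (F \<inter> U) = F" if "U \<in> \<U> \<union> \<V>" for U
  proof
    show "closure (F \<inter> U) \<subseteq> F"
      using F(1) by (simp add: closure_minimal)
    from that have "?A \<subseteq> U \<or> ?B \<subseteq> U"
      using \<U>(3) \<V>(3) by blast
    then have "closure (?A \<inter> F) \<subseteq> closure (F \<inter> U) \<or> closure (?B \<inter> F) \<subseteq> closure (F \<inter> U)"
      by (meson closure_mono Int_greatest Int_lower1 Int_lower2 order_trans)
    then show "F \<subseteq> closure (F \<inter> U)"
      unfolding A B by blast
  qed
  have "top_of_set F closure_of \<Inter>(insert F ((\<inter>) F ` (\<U> \<union> \<V>))) = topspace (top_of_set F)"
  proof (rule Baire_category)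
    show "completely_metrizable_space (top_of_set F) \<or>
        locally_compact_space (top_of_set F) \<and> regular_space (top_of_set F)"
      using F(1) completely_metrizable_space_closedin completely_metrizable_space_euclidean
      by (metis closed_closedin)
    show "countable (insert F ((\<inter>) F ` (\<U> \<union> \<V>)))"
      using \<U>(1) \<V>(1) by simp
    show "openin (top_of_set F) T \<and> top_of_set F closure_of T = topspace (top_of_set F)"
      if "T \<in> insert F ((\<inter>) F ` (\<U> \<union> \<V>))" for T
    proof -
      consider "T = F" | U where "T = F \<inter> U" "U \<in> \<U> \<union> \<V>"
        using \<open>T \<in> insert F ((\<inter>) F ` (\<U> \<union> \<V>))\<close> by blast
      then show ?thesis
      proof cases
        case 1
        then show ?thesis
          using closure_of_topspace[of "top_of_set F"] by simp
      next
        case 2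
        then have "open U"
          using \<U>(2) \<V>(2) by blast
        then show ?thesis
          using 2 dense[of U] by (simp add: closure_of_subtopology openin_open_Int)
      qed
    qed
  qed
  moreover have "\<Inter>(insert F ((\<inter>) F ` (\<U> \<union> \<V>))) = {}"
  proof -
    have "x \<notin> ?A \<or> x \<notin> ?B" for x
      using \<open>p < q\<close> by auto
    then have "\<exists>U\<in>\<U> \<union> \<V>. x \<notin> U" for x
      using \<U>(3) \<V>(3) by (metis Inter_iff UnI1 UnI2)
    then show ?thesis
      by auto
  qed
  ultimately show "F = {}"
    by simp
qed

text \<open>There is one slot per pair of rationals. For \<open>f < g\<close> each slot keeps its
  colours or moves up, and rationals \<open>c < d\<close> strictly between \<open>f x\<close> and
  \<open>g x\<close> give a slot that moves up; the first such slot decides.\<close>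

lemma colourable_if_order_embeds_baire1:
  assumes "order_embeds r (baire1_order :: ('x::polish_space \<Rightarrow> real) rel)"
  shows "colourable r"
proof -
  obtain \<Phi> :: "'a \<Rightarrow> 'x \<Rightarrow> real" where emb: "\<Phi> ` Field r \<subseteq> Field baire1_order"
    "\<forall>p q. (p, q) \<in> r - Id \<longrightarrow> (\<Phi> p, \<Phi> q) \<in> baire1_order - Id"
    using assms unfolding order_embeds_def by (elim exE conjE)
  have \<Phi>: "p \<in> Field r \<Longrightarrow> baire_class1 (\<Phi> p)"
    "(p, q) \<in> r - Id \<Longrightarrow> \<Phi> p \<le> \<Phi> q \<and> \<Phi> p \<noteq> \<Phi> q" for p q
    using emb unfolding strict_baire1_order Field_baire1_order by auto
  obtain u :: "'x set \<Rightarrow> real" where "strictly_antitone_on_closed u"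
    using strictly_antitone_on_closed_exists .
  then interpret strictly_antitone_on_closed u .
  obtain a w where "slots natLeq a w"
    using slots_exist[OF natLeq_Well_order] by auto
  then interpret slots natLeq a w .
  \<comment> \<open>Codes of pairs without \<open>p < q\<close> get a constant colouring shared by
    all functions.\<close>
  define s where "s n f = (let (p, q) = from_nat n :: rat \<times> rat in
     if p < q then colour {x. of_rat q \<le> f x} {x. f x \<le> of_rat p} else (\<lambda>_. False))" for n and f :: "'x \<Rightarrow> real"
  have s_eq: "s n f = colour {x. of_rat q \<le> f x} {x. f x \<le> of_rat p}" if "from_nat n = (p, q)" "p < q" for n p q and f :: "'x \<Rightarrow> real"
    using that by (simp add: s_def)
  have rlc: "right_locally_constant (s n f)" if "baire_class1 f" for n and f :: "'x \<Rightarrow> real"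
  proof -
    obtain p q :: rat where pq: "from_nat n = (p, q)"
      by fastforce
    show ?thesis
    proof (cases "p < q")
      case True
      then show ?thesis
        unfolding s_eq[OF pq True]
        by (intro right_locally_constant_colour exhausting_level_sets that) (simp add: of_rat_less)
    next
      case False
      then show ?thesis
        using pq by (simp add: s_def right_locally_constant_const)
    qed
  qed
  have mono: "(\<forall>x\<in>{0..<1}. s n f x = s n g x) \<or> lexless (s n f) (s n g)"
    and strict: "from_nat n = (p, q) \<Longrightarrow> p < q \<Longrightarrow> f x < of_rat p \<Longrightarrow> of_rat q < g x \<Longrightarrow> lexless (s n f) (s n g)"
    if f: "baire_class1 f" and g: "baire_class1 g" and fg: "f \<le> g" for n p q x and f g :: "'x \<Rightarrow> real"
  proof -
    have cm: "(\<forall>x\<in>{0..<1}. s n f x = s n g x) \<and> {x. f x \<le> of_rat p} \<inter> {x. of_rat q \<le> g x} = {} \<or>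
       lexless (s n f) (s n g)" if pq: "from_nat n = (p, q)" "p < q" for p q
      unfolding s_eq[OF pq] using fg pq(2)
      by (intro colour_mono exhausting_level_sets f g) (auto simp: of_rat_less le_fun_def intro: order_trans)
    obtain p' q' :: rat where pq': "from_nat n = (p', q')"
      by fastforce
    show "(\<forall>x\<in>{0..<1}. s n f x = s n g x) \<or> lexless (s n f) (s n g)"
    proof (cases "p' < q'")
      case True
      then show ?thesis using cm[OF pq'] by blast
    qed (simp add: s_def pq')
    show "lexless (s n f) (s n g)" if "from_nat n = (p, q)" "p < q" "f x < of_rat p" "of_rat q < g x"
    proof -
      have "x \<in> {x. f x \<le> of_rat p} \<inter> {x. of_rat q \<le> g x}"
        using that by simp
      then show ?thesis
        using cm[OF that(1,2)] by blast
    qed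
  qed
  define \<Psi> where "\<Psi> p = concat_slots (\<lambda>n. s n (\<Phi> p))" for p
  show ?thesis
    unfolding colourable_def
  proof (intro exI[of _ \<Psi>] conjI ballI allI impI)
    show "right_locally_constant (\<Psi> p)" if "p \<in> Field r" for p
      unfolding \<Psi>_def using rlc \<Phi>(1)[OF that] by (intro right_locally_constant_concat_slots)
    fix p q assume pq: "(p, q) \<in> r - Id"
    then have b: "baire_class1 (\<Phi> p)" "baire_class1 (\<Phi> q)" "\<Phi> p \<le> \<Phi> q" "\<Phi> p \<noteq> \<Phi> q"
      using \<Phi> by (auto intro: FieldI1 FieldI2)
    then obtain x where "\<Phi> p x < \<Phi> q x"
      by (metis antisym le_funD le_funI linorder_not_less)
    then obtain c where c: "\<Phi> p x < of_rat c" "of_rat c < \<Phi> q x"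
      using of_rat_dense by blast
    then obtain d where d: "of_rat c < (of_rat d :: real)" "of_rat d < \<Phi> q x"
      using of_rat_dense by blast
    have "lexless (s (to_nat (c, d)) (\<Phi> p)) (s (to_nat (c, d)) (\<Phi> q))"
      using strict[OF b(1-3), of "to_nat (c, d)" c d x] c d by (simp add: of_rat_less)
    define n where "n = (LEAST n. lexless (s n (\<Phi> p)) (s n (\<Phi> q)))"
    have n: "lexless (s n (\<Phi> p)) (s n (\<Phi> q))"
      unfolding n_def by (rule LeastI) fact
    have before: "s m (\<Phi> p) x = s m (\<Phi> q) x" if "m < n" "x \<in> {0..<1}" for m x
      using not_less_Least[OF that(1)[unfolded n_def]] mono[OF b(1-3), of m] that(2) by blast
    show "lexless (\<Psi> p) (\<Psi> q)"
      unfolding \<Psi>_def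
    proof (rule lexless_concat_slots)
      show "lexless (s n (\<Phi> p)) (s n (\<Phi> q))" by fact
      show "s m (\<Phi> p) x = s m (\<Phi> q) x" if "(m, n) \<in> natLeq - Id" "x \<in> {0..<1}" for m x
        using before that by (auto simp: natLeq_def)
    qed (simp add: Field_natLeq)
  qed
qed

section \<open>Transfer to representable orders\<close>

lemma colourable_iff_order_embeds_baire1:
  assumes "uncountable (UNIV :: 'x::polish_space set)"
  shows "colourable r \<longleftrightarrow> order_embeds r (baire1_order :: ('x \<Rightarrow> real) rel)"
  using order_embeds_baire1_if_colourable[OF assms] colourable_if_order_embeds_baire1 by blast

lemma countable_Field_if_less_omega1:
  assumes "(\<alpha>, omega1) \<in> ordLess"
  shows "countable (Field \<alpha>)"
proof -
  have "(card_of (Field \<alpha>), \<alpha>) \<in> ordLeq"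
    using assms by (intro card_of_least) (auto simp: ordLess_def)
  then have "(card_of (Field \<alpha>), omega1) \<in> ordLess"
    using assms by (rule ordLeq_ordLess_trans)
  then have "(card_of (Field \<alpha>), natLeq) \<in> ordLeq"
    using cardSuc_ordLeq_ordLess[OF natLeq_Card_order card_of_Card_order] by blast
  then have "(card_of (Field \<alpha>), card_of (UNIV :: nat set)) \<in> ordLeq"
    using ordIso_symmetric[OF card_of_nat] by (rule ordLeq_ordIso_trans)
  then obtain f :: "_ \<Rightarrow> nat" where "inj_on f (Field \<alpha>)"
    unfolding card_of_ordLeq[symmetric] by blast
  then show ?thesis
    by (rule countableI)
qed

theorem theorem5p2:
  assumes "uncountable (UNIV :: 'x::polish_space set)"
  shows "(\<forall>(\<alpha> :: 'i rel) (L :: 'i \<Rightarrow> 'a rel).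
            (\<alpha>, omega1) \<in> ordLess \<longrightarrow>
            (\<forall>\<beta>\<in>Field \<alpha>. representable TYPE('x) (L \<beta>)) \<longrightarrow>
            representable TYPE('x) (lex_product \<alpha> L)) \<and>
         (\<forall>(L :: 'p rel) (M :: 'p \<Rightarrow> 'q rel).
            representable TYPE('x) L \<longrightarrow>
            (\<forall>p\<in>Field L. representable TYPE('x) (M p)) \<longrightarrow>
            representable TYPE('x) (gluing L M))"
proof (intro conjI allI impI)
  fix \<alpha> :: "'i rel" and L :: "'i \<Rightarrow> 'a rel"
  assume \<alpha>: "(\<alpha>, omega1) \<in> ordLess" and L: "\<forall>\<beta>\<in>Field \<alpha>. representable TYPE('x) (L \<beta>)"
  have "Well_order \<alpha>"
    using \<alpha> by (auto simp: ordLess_def)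
  moreover have "Linear_order (L \<beta>)" "colourable (L \<beta>)" if "\<beta> \<in> Field \<alpha>" for \<beta>
    using L that colourable_iff_order_embeds_baire1[OF assms] by (auto simp: representable_def)
  ultimately show "representable TYPE('x) (lex_product \<alpha> L)"
    using countable_Field_if_less_omega1[OF \<alpha>]
    by (simp add: representable_def colourable_iff_order_embeds_baire1[OF assms, symmetric]
        Linear_order_lex_product colourable_lex_product)
next
  fix L :: "'p rel" and M :: "'p \<Rightarrow> 'q rel"
  assume "representable TYPE('x) L" and "\<forall>p\<in>Field L. representable TYPE('x) (M p)"
  then have "Linear_order L" "colourable L"
    and "\<And>p. p \<in> Field L \<Longrightarrow> Linear_order (M p)" "\<And>p. p \<in> Field L \<Longrightarrow> colourable (M p)"
    using colourable_iff_order_embeds_baire1[OF assms] by (auto simp: representable_def)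
  then show "representable TYPE('x) (gluing L M)"
    by (simp add: representable_def colourable_iff_order_embeds_baire1[OF assms, symmetric]
        Linear_order_gluing colourable_gluing)
qed

end
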